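(* Let $k$ be an algebraically closed field of characteristic $2$, let $\omega\in k$ be a root of $x^2+x+1$ (a primitive cube root of unity), and let $K=\langle(1,2,3)\rangle\le A_4$. Put $$e_1=()+(1,2,3)+(1,3,2),\quad e_2=()+\omega(1,2,3)+\omega^2(1,3,2),\quad e_3=()+\omega^2(1,2,3)+\omega(1,3,2),$$ where $()$ is the identity permutation. Then $e_1,e_2,e_3$ are the central orthogonal idempotents in $kK$; in $kA_4$ they are primitive orthogonal idempotents with $1=e_1+e_2+e_3$. The corresponding decomposition of $kA_4$ as a direct sum of submodules is $$kA_4=kA_4e_1\oplus kA_4e_2\oplus kA_4e_3,$$ and $Q_i=kA_4e_i$ for $i=1,2,3$.
   Context: An idempotent is primitive if it is nonzero and cannot be written as a sum of two nonzero orthogonal idempotents. $kA_4$ is regarded as a left module over itself. Let $V_4=\langle(1,2)(3,4),(1,3)(2,4)\rangle\trianglelefteq A_4$. The simple left $kA_4$-modules are the one-dimensional modules $T_1,T_2,T_3$ on which $V_4$ acts trivially and $(1,2,3)$ acts as multiplication by $1$, $\omega$, $\omega^2$ respectively. For $i=1,2,3$, $Q_i$ denotes the projective cover of $T_i$ (determined up to isomorphism); these are the projective indecomposable $kA_4$-modules, and $kA_4\cong Q_1\oplus Q_2\oplus Q_3$.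
   Formalization: The last clause is corrected to Q_1 = kA_4e_1, Q_2 = kA_4e_3, Q_3 = kA_4e_2: as printed it fails for i = 2, 3, because (1,2,3)e_2 = ω^2 e_2, so e_2 annihilates T_2 (and e_3 annihilates T_3). *)

theory Defs
  imports
    "HOL-Computational_Algebra.Polynomial"
    "HOL-Algebra.Sym_Groups"
    "HOL-Algebra.Generated_Groups"
    "HOL-Algebra.Module"
begin

section \<open>Idempotents\<close>

definition idempotent_elem :: "('r, 'n) ring_scheme \<Rightarrow> 'r \<Rightarrow> bool" where
  "idempotent_elem R e \<longleftrightarrow> e \<in> carrier R \<and> e \<otimes>\<^bsub>R\<^esub> e = e"

definition orthogonal_elems :: "('r, 'n) ring_scheme \<Rightarrow> 'r \<Rightarrow> 'r \<Rightarrow> bool" where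
  "orthogonal_elems R a b \<longleftrightarrow> a \<otimes>\<^bsub>R\<^esub> b = \<zero>\<^bsub>R\<^esub> \<and> b \<otimes>\<^bsub>R\<^esub> a = \<zero>\<^bsub>R\<^esub>"

definition primitive_idempotent :: "('r, 'n) ring_scheme \<Rightarrow> 'r \<Rightarrow> bool" where
  "primitive_idempotent R e \<longleftrightarrow>
     idempotent_elem R e \<and> e \<noteq> \<zero>\<^bsub>R\<^esub> \<and>
     \<not> (\<exists>a b. idempotent_elem R a \<and> idempotent_elem R b \<and> a \<noteq> \<zero>\<^bsub>R\<^esub> \<and> b \<noteq> \<zero>\<^bsub>R\<^esub> \<and>
             orthogonal_elems R a b \<and> e = a \<oplus>\<^bsub>R\<^esub> b)"

definition central_elem :: "('r, 'n) ring_scheme \<Rightarrow> 'r \<Rightarrow> bool" where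
  "central_elem R z \<longleftrightarrow>
     z \<in> carrier R \<and> (\<forall>x\<in>carrier R. z \<otimes>\<^bsub>R\<^esub> x = x \<otimes>\<^bsub>R\<^esub> z)"

section \<open>Left modules over a not necessarily commutative ring\<close>

text \<open>The library locale \<open>module\<close> requires a commutative ring of scalars. Its record
  type and the locale \<open>submodule\<close>, which do not, are reused here; the fields \<open>mult\<close> and \<open>one\<close>
  that the record inherits from \<open>ring\<close> play no role.\<close>

locale left_module = R?: ring R + M?: abelian_group M
  for R :: "('r, 'n) ring_scheme" (structure) and M :: "('r, 'm, 'z) module_scheme" (structure) +
  assumes smult_closed:
      "\<lbrakk>a \<in> carrier R; x \<in> carrier M\<rbrakk> \<Longrightarrow> a \<odot>\<^bsub>M\<^esub> x \<in> carrier M"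
    and smult_l_distr:
      "\<lbrakk>a \<in> carrier R; b \<in> carrier R; x \<in> carrier M\<rbrakk> \<Longrightarrow>
       (a \<oplus>\<^bsub>R\<^esub> b) \<odot>\<^bsub>M\<^esub> x = a \<odot>\<^bsub>M\<^esub> x \<oplus>\<^bsub>M\<^esub> b \<odot>\<^bsub>M\<^esub> x"
    and smult_r_distr:
      "\<lbrakk>a \<in> carrier R; x \<in> carrier M; y \<in> carrier M\<rbrakk> \<Longrightarrow>
       a \<odot>\<^bsub>M\<^esub> (x \<oplus>\<^bsub>M\<^esub> y) = a \<odot>\<^bsub>M\<^esub> x \<oplus>\<^bsub>M\<^esub> a \<odot>\<^bsub>M\<^esub> y"
    and smult_assoc:
      "\<lbrakk>a \<in> carrier R; b \<in> carrier R; x \<in> carrier M\<rbrakk> \<Longrightarrow>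
       (a \<otimes>\<^bsub>R\<^esub> b) \<odot>\<^bsub>M\<^esub> x = a \<odot>\<^bsub>M\<^esub> (b \<odot>\<^bsub>M\<^esub> x)"
    and smult_one:
      "x \<in> carrier M \<Longrightarrow> \<one>\<^bsub>R\<^esub> \<odot>\<^bsub>M\<^esub> x = x"

definition left_module_hom ::
  "('r, 'n) ring_scheme \<Rightarrow> ('r, 'm) module \<Rightarrow> ('r, 'p) module \<Rightarrow> ('m \<Rightarrow> 'p) set" where
  "left_module_hom R M N =
     {f \<in> carrier M \<rightarrow> carrier N.
        (\<forall>x\<in>carrier M. \<forall>y\<in>carrier M. f (x \<oplus>\<^bsub>M\<^esub> y) = f x \<oplus>\<^bsub>N\<^esub> f y) \<and>
        (\<forall>a\<in>carrier R. \<forall>x\<in>carrier M. f (a \<odot>\<^bsub>M\<^esub> x) = a \<odot>\<^bsub>N\<^esub> f x)}"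

definition regular_module :: "('r, 'n) ring_scheme \<Rightarrow> ('r, 'r) module" where
  "regular_module R =
     \<lparr>carrier = carrier R, mult = mult R, one = one R, zero = zero R, add = add R, smult = mult R\<rparr>"

definition left_ideal_gen :: "('r, 'n) ring_scheme \<Rightarrow> 'r \<Rightarrow> 'r set" where
  "left_ideal_gen R e = {a \<otimes>\<^bsub>R\<^esub> e | a. a \<in> carrier R}"

definition left_ideal_module :: "('r, 'n) ring_scheme \<Rightarrow> 'r \<Rightarrow> ('r, 'r) module" where
  "left_ideal_module R e = (regular_module R)\<lparr>carrier := left_ideal_gen R e\<rparr>"

definition internal_direct_sum ::
  "('r, 'n) ring_scheme \<Rightarrow> ('r, 'm) module \<Rightarrow> 'i set \<Rightarrow> ('i \<Rightarrow> 'm set) \<Rightarrow> bool" where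
  "internal_direct_sum R M I N \<longleftrightarrow>
     (\<forall>i\<in>I. submodule (N i) R M) \<and>
     (\<forall>x\<in>carrier M. \<exists>!f. f \<in> (\<Pi>\<^sub>E i\<in>I. N i) \<and> x = (\<Oplus>\<^bsub>M\<^esub>i\<in>I. f i))"

definition free_left_module :: "('r, 'n) ring_scheme \<Rightarrow> 'i set \<Rightarrow> ('r, 'i \<Rightarrow> 'r) module" where
  "free_left_module R I =
     \<lparr>carrier = {f. (\<forall>i\<in>I. f i \<in> carrier R) \<and> (\<forall>i. i \<notin> I \<longrightarrow> f i = \<zero>\<^bsub>R\<^esub>) \<and>
                    finite {i. f i \<noteq> \<zero>\<^bsub>R\<^esub>}},
      mult = (\<lambda>f g i. f i \<otimes>\<^bsub>R\<^esub> g i), one = (\<lambda>i. \<one>\<^bsub>R\<^esub>),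
      zero = (\<lambda>i. \<zero>\<^bsub>R\<^esub>), add = (\<lambda>f g i. f i \<oplus>\<^bsub>R\<^esub> g i),
      smult = (\<lambda>a f i. a \<otimes>\<^bsub>R\<^esub> f i)\<rparr>"

text \<open>Projective means being a direct summand of a free module. Taking the index set among the
  elements of \<open>P\<close> loses nothing: if \<open>P\<close> is a summand of some free module, then the canonical
  surjection onto \<open>P\<close> from the free module on \<open>carrier P\<close> splits.\<close>

definition projective_left_module :: "('r, 'n) ring_scheme \<Rightarrow> ('r, 'm) module \<Rightarrow> bool" where
  "projective_left_module R P \<longleftrightarrow>
     left_module R P \<and>
     (\<exists>(I :: 'm set) j p.
        j \<in> left_module_hom R P (free_left_module R I) \<and>
        p \<in> left_module_hom R (free_left_module R I) P \<and>
        (\<forall>x\<in>carrier P. p (j x) = x))"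

definition essential_epi ::
  "('r, 'n) ring_scheme \<Rightarrow> ('r, 'm) module \<Rightarrow> ('r, 'p) module \<Rightarrow> ('m \<Rightarrow> 'p) \<Rightarrow> bool" where
  "essential_epi R P M f \<longleftrightarrow>
     f \<in> left_module_hom R P M \<and> f ` carrier P = carrier M \<and>
     (\<forall>U. submodule U R P \<and> f ` U = carrier M \<longrightarrow> U = carrier P)"

definition is_projective_cover ::
  "('r, 'n) ring_scheme \<Rightarrow> ('r, 'm) module \<Rightarrow> ('r, 'p) module \<Rightarrow> bool" where
  "is_projective_cover R P M \<longleftrightarrow>
     projective_left_module R P \<and> left_module R M \<and> (\<exists>f. essential_epi R P M f)"

section \<open>Group algebras\<close>

text \<open>Elements are the finitely supported coefficient functions vanishing outside \<open>carrier G\<close>.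
  For a subgroup \<open>H\<close> the algebra of \<open>G\<lparr>carrier := H\<rparr>\<close> is therefore literally a subring of that
  of \<open>G\<close>.\<close>

definition group_algebra :: "('g, 'b) monoid_scheme \<Rightarrow> ('g \<Rightarrow> 'k::field) ring" where
  "group_algebra G =
     \<lparr>carrier = {f. finite {g. f g \<noteq> 0} \<and> {g. f g \<noteq> 0} \<subseteq> carrier G},
      mult = (\<lambda>f h x. \<Sum>(y, z) \<in> {(y, z). f y \<noteq> 0 \<and> h z \<noteq> 0 \<and> y \<otimes>\<^bsub>G\<^esub> z = x}. f y * h z),
      one = (\<lambda>x. if x = \<one>\<^bsub>G\<^esub> then 1 else 0),
      zero = (\<lambda>x. 0),
      add = (\<lambda>f h x. f x + h x)\<rparr>"

definition ga_single :: "'g \<Rightarrow> 'k::field \<Rightarrow> 'g \<Rightarrow> 'k" where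
  "ga_single g a = (\<lambda>x. if x = g then a else 0)"

section \<open>The alternating group of degree 4\<close>

abbreviation A4 :: "(nat \<Rightarrow> nat) monoid" where
  "A4 \<equiv> alt_group 4"

definition c123 :: "nat \<Rightarrow> nat" where "c123 = cycle_of_list [1, 2, 3]"
definition c132 :: "nat \<Rightarrow> nat" where "c132 = cycle_of_list [1, 3, 2]"

definition V4 :: "(nat \<Rightarrow> nat) set" where
  "V4 = generate A4 {cycle_of_list [1, 2] \<circ> cycle_of_list [3, 4],
                     cycle_of_list [1, 3] \<circ> cycle_of_list [2, 4]}"

definition K3 :: "(nat \<Rightarrow> nat) set" where
  "K3 = generate A4 {c123}"

abbreviation kA4 :: "((nat \<Rightarrow> nat) \<Rightarrow> 'k::field) ring" where
  "kA4 \<equiv> group_algebra A4"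

abbreviation kK :: "((nat \<Rightarrow> nat) \<Rightarrow> 'k::field) ring" where
  "kK \<equiv> group_algebra (A4\<lparr>carrier := K3\<rparr>)"

definition e_idem :: "'k::field \<Rightarrow> nat \<Rightarrow> (nat \<Rightarrow> nat) \<Rightarrow> 'k" where
  "e_idem \<omega> i =
     (if i = 1 then ga_single id 1 \<oplus>\<^bsub>kA4\<^esub> ga_single c123 1 \<oplus>\<^bsub>kA4\<^esub> ga_single c132 1
      else if i = 2 then ga_single id 1 \<oplus>\<^bsub>kA4\<^esub> ga_single c123 \<omega> \<oplus>\<^bsub>kA4\<^esub> ga_single c132 (\<omega>^2)
      else ga_single id 1 \<oplus>\<^bsub>kA4\<^esub> ga_single c123 (\<omega>^2) \<oplus>\<^bsub>kA4\<^esub> ga_single c132 \<omega>)"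

text \<open>The modules \<open>T\<^sub>1, T\<^sub>2, T\<^sub>3\<close> are those with \<open>\<mu> = 1, \<omega>, \<omega>\<^sup>2\<close>. A scalar \<open>a\<close> of the field acts
  as \<open>ga_single id a\<close>.\<close>

definition one_dim_A4_module :: "'k::field \<Rightarrow> ((nat \<Rightarrow> nat) \<Rightarrow> 'k, 'm) module \<Rightarrow> bool" where
  "one_dim_A4_module \<mu> T \<longleftrightarrow>
     left_module kA4 T \<and>
     (\<exists>t\<in>carrier T. t \<noteq> \<zero>\<^bsub>T\<^esub> \<and> carrier T = {ga_single id a \<odot>\<^bsub>T\<^esub> t | a. True}) \<and>
     (\<forall>v\<in>V4. \<forall>t\<in>carrier T. ga_single v 1 \<odot>\<^bsub>T\<^esub> t = t) \<and>
     (\<forall>t\<in>carrier T. ga_single c123 1 \<odot>\<^bsub>T\<^esub> t = ga_single id \<mu> \<odot>\<^bsub>T\<^esub> t)"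

text \<open>Pitfall: \<open>(1,2,3) e\<^sub>2 = \<omega>\<^sup>2 e\<^sub>2\<close> and \<open>(1,2,3) e\<^sub>3 = \<omega> e\<^sub>3\<close>. So for left modules it is
  \<open>kA\<^sub>4 e\<^sub>3\<close> that covers \<open>T\<^sub>2\<close>, and \<open>kA\<^sub>4 e\<^sub>2\<close> that covers \<open>T\<^sub>3\<close>; \<open>e\<^sub>2\<close> annihilates \<open>T\<^sub>2\<close>, and
  \<open>e\<^sub>3\<close> annihilates \<open>T\<^sub>3\<close>.\<close>

end

theory Submission
  imports Defs
begin

text \<open>
  Write \<open>c = c123\<close>, and \<open>e = 1 + \<chi> c + \<chi>\<^sup>2 c\<^sup>2\<close> for a cube root of unity \<open>\<chi>\<close>. Then \<open>c e = \<chi>\<^sup>2 e = e c\<close>, and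
  this makes the three elements \<open>e\<close> orthogonal idempotents (as \<open>3 = 1\<close>) with sum 1. The algebra
  \<open>kK\<close> is spanned by them, so it is commutative and they are its only primitive idempotents
  (\<open>primitive_kK_cases\<close>). A decomposition of the unit of any ring into orthogonal idempotents decomposes
  the ring into projective left ideals (\<open>internal_direct_sum_left_ideals\<close>, \<open>left_ideal_projective\<close>).

  What remains concerns the corner \<open>e kA4 e\<close>. As \<open>A4 = V4 K3\<close> and \<open>K3\<close> permutes the three involutions of
  \<open>V4\<close> transitively, it is spanned by \<open>e\<close> and \<open>z = (v1 + v2 + v3) e\<close> (\<open>corner_element\<close>). In
  characteristic 2, \<open>z\<^sup>2 = e\<close> and hence \<open>(\<alpha> e + \<beta> z)\<^sup>2 = (\<alpha> + \<beta>)\<^sup>2 e\<close> (\<open>corner_square\<close>): the corner is a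
  local ring with residue map \<open>\<alpha> e + \<beta> z \<mapsto> \<alpha> + \<beta>\<close>. This one identity yields both main
  assertions. An idempotent in the corner equals its square, so it is a multiple of \<open>e\<close>, and \<open>e\<close> is
  primitive (\<open>K3_idem_primitive\<close>). On a simple module \<open>T\<close> on which \<open>c\<close> acts as \<open>1 / \<chi>\<close>, the corner acts through
  the residue map, so a submodule of \<open>kA4 e\<close> that maps onto \<open>T\<close> contains an element of the corner with
  residue 1, whose square is \<open>e\<close>. Hence \<open>kA4 e \<rightarrow> T\<close> is essential and \<open>kA4 e\<close> is the projective cover of \<open>T\<close>
  (\<open>K3_idem_projective_cover\<close>).
\<close>

section \<open>The group algebra of a monoid\<close>

text \<open>The defining sum of a product runs over the pairs in the supports, which vary with the factors.
  Over fixed finite index sets containing the supports, the product is visibly bilinear.\<close>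

lemma group_algebra_mult_apply:
  fixes f h :: "'g \<Rightarrow> 'k::field"
  assumes "finite A" "finite B" "{g. f g \<noteq> 0} \<subseteq> A" "{g. h g \<noteq> 0} \<subseteq> B"
  shows "(f \<otimes>\<^bsub>group_algebra G\<^esub> h) x =
           (\<Sum>y\<in>A. \<Sum>z\<in>B. if y \<otimes>\<^bsub>G\<^esub> z = x then f y * h z else 0)"
proof -
  let ?S = "{(y, z). f y \<noteq> 0 \<and> h z \<noteq> 0 \<and> y \<otimes>\<^bsub>G\<^esub> z = x}"
  have "(f \<otimes>\<^bsub>group_algebra G\<^esub> h) x = (\<Sum>(y, z)\<in>?S. f y * h z)"
    by (simp add: group_algebra_def)
  also have "\<dots> = (\<Sum>(y, z)\<in>A \<times> B. if y \<otimes>\<^bsub>G\<^esub> z = x then f y * h z else 0)"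
    using assms by (intro sum.mono_neutral_cong_left) (auto split: if_splits)
  also have "\<dots> = (\<Sum>y\<in>A. \<Sum>z\<in>B. if y \<otimes>\<^bsub>G\<^esub> z = x then f y * h z else 0)"
    by (simp add: sum.cartesian_product)
  finally show ?thesis .
qed

lemma group_algebra_add: "f \<oplus>\<^bsub>group_algebra G\<^esub> h = (\<lambda>x. f x + h x)"
  and group_algebra_zero: "\<zero>\<^bsub>group_algebra G\<^esub> = (\<lambda>x. 0)"
  and group_algebra_one: "\<one>\<^bsub>group_algebra G\<^esub> = ga_single \<one>\<^bsub>G\<^esub> 1"
  by (simp_all add: group_algebra_def ga_single_def)

lemma group_algebra_carrier:
  "f \<in> carrier (group_algebra G) \<longleftrightarrow> finite {g. f g \<noteq> 0} \<and> {g. f g \<noteq> 0} \<subseteq> carrier G"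
  by (simp add: group_algebra_def)

lemma ga_single_closed [simp]: "g \<in> carrier G \<Longrightarrow> ga_single g a \<in> carrier (group_algebra G)"
  by (auto simp: group_algebra_carrier ga_single_def)

lemma ga_single_mult:
  "ga_single g a \<otimes>\<^bsub>group_algebra G\<^esub> ga_single h b = ga_single (g \<otimes>\<^bsub>G\<^esub> h) (a * b)"
  by (rule ext, subst group_algebra_mult_apply[of "{g}" "{h}"]) (auto simp: ga_single_def)

lemma ga_single_add: "ga_single g a \<oplus>\<^bsub>group_algebra G\<^esub> ga_single g b = ga_single g (a + b)"
  by (auto simp: ga_single_def group_algebra_add)

lemma group_algebra_add_closed:
  assumes "f \<in> carrier (group_algebra G)" "h \<in> carrier (group_algebra G)"
  shows "f \<oplus>\<^bsub>group_algebra G\<^esub> h \<in> carrier (group_algebra G)"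
proof -
  have "{g. f g + h g \<noteq> 0} \<subseteq> {g. f g \<noteq> 0} \<union> {g. h g \<noteq> 0}" by auto
  then show ?thesis
    using assms unfolding group_algebra_carrier group_algebra_add
    by (meson finite_UnI finite_subset le_sup_iff order_trans)
qed

text \<open>The basis elements span, so an additive property need only be checked on them. Together with
  distributivity this reduces associativity and the unit laws to the monoid laws of \<open>G\<close>.\<close>

lemma group_algebra_induct [consumes 1, case_names zero single add]:
  fixes f :: "'g \<Rightarrow> 'k::field"
  assumes f: "f \<in> carrier (group_algebra G)"
    and zero: "P \<zero>\<^bsub>group_algebra G\<^esub>"
    and single: "\<And>g a. g \<in> carrier G \<Longrightarrow> P (ga_single g a)"
    and add: "\<And>f h. f \<in> carrier (group_algebra G) \<Longrightarrow> h \<in> carrier (group_algebra G) \<Longrightarrow>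
                P f \<Longrightarrow> P h \<Longrightarrow> P (f \<oplus>\<^bsub>group_algebra G\<^esub> h)"
  shows "P f"
proof -
  have "P f" if "finite A" "A \<subseteq> carrier G" "{g. f g \<noteq> 0} \<subseteq> A" for A and f :: "'g \<Rightarrow> 'k"
    using that
  proof (induction A arbitrary: f rule: finite_induct)
    case empty
    then have "f = \<zero>\<^bsub>group_algebra G\<^esub>" by (auto simp: group_algebra_zero)
    then show ?case using zero by simp
  next
    case (insert g A)
    let ?h = "f(g := 0)"
    have sub: "{x. ?h x \<noteq> 0} \<subseteq> A" using insert.prems insert.hyps by auto
    have "P ?h" using insert.prems sub by (intro insert.IH) auto
    moreover have "?h \<in> carrier (group_algebra G)"
      using sub insert unfolding group_algebra_carrier by (meson finite_subset insert_subset order_trans)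
    moreover have "f = ga_single g (f g) \<oplus>\<^bsub>group_algebra G\<^esub> ?h"
      by (auto simp: ga_single_def group_algebra_add)
    ultimately show ?case
      using add[of "ga_single g (f g)" ?h] single[of g "f g"] insert.prems
      by (metis ga_single_closed insert_subset)
  qed
  then show ?thesis using f by (auto simp: group_algebra_carrier)
qed

lemma group_algebra_l_distr:
  assumes "f \<in> carrier (group_algebra G)" "f' \<in> carrier (group_algebra G)"
    "h \<in> carrier (group_algebra G)"
  shows "(f \<oplus>\<^bsub>group_algebra G\<^esub> f') \<otimes>\<^bsub>group_algebra G\<^esub> h =
    f \<otimes>\<^bsub>group_algebra G\<^esub> h \<oplus>\<^bsub>group_algebra G\<^esub> f' \<otimes>\<^bsub>group_algebra G\<^esub> h"
proof
  fix x
  let ?A = "{g. f g \<noteq> 0} \<union> {g. f' g \<noteq> 0}" and ?B = "{g. h g \<noteq> 0}"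
  have fin: "finite ?A" "finite ?B" using assms by (auto simp: group_algebra_carrier)
  note * = group_algebra_mult_apply[OF fin, of _ h G x]
  show "((f \<oplus>\<^bsub>group_algebra G\<^esub> f') \<otimes>\<^bsub>group_algebra G\<^esub> h) x =
    (f \<otimes>\<^bsub>group_algebra G\<^esub> h \<oplus>\<^bsub>group_algebra G\<^esub> f' \<otimes>\<^bsub>group_algebra G\<^esub> h) x"
    unfolding group_algebra_add
    by (subst *, auto simp: *[of f] *[of f'] sum.distrib[symmetric] algebra_simps intro!: sum.cong)
qed

lemma group_algebra_r_distr:
  assumes "f \<in> carrier (group_algebra G)" "f' \<in> carrier (group_algebra G)"
    "h \<in> carrier (group_algebra G)"
  shows "h \<otimes>\<^bsub>group_algebra G\<^esub> (f \<oplus>\<^bsub>group_algebra G\<^esub> f') =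
    h \<otimes>\<^bsub>group_algebra G\<^esub> f \<oplus>\<^bsub>group_algebra G\<^esub> h \<otimes>\<^bsub>group_algebra G\<^esub> f'"
proof
  fix x
  let ?A = "{g. f g \<noteq> 0} \<union> {g. f' g \<noteq> 0}" and ?B = "{g. h g \<noteq> 0}"
  have fin: "finite ?A" "finite ?B" using assms by (auto simp: group_algebra_carrier)
  note * = group_algebra_mult_apply[OF fin(2,1), of h _ G x]
  show "(h \<otimes>\<^bsub>group_algebra G\<^esub> (f \<oplus>\<^bsub>group_algebra G\<^esub> f')) x =
    (h \<otimes>\<^bsub>group_algebra G\<^esub> f \<oplus>\<^bsub>group_algebra G\<^esub> h \<otimes>\<^bsub>group_algebra G\<^esub> f') x"
    unfolding group_algebra_add
    by (subst *, auto simp: *[of f] *[of f'] sum.distrib[symmetric] algebra_simps intro!: sum.cong)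
qed

lemma group_algebra_mult_zero [simp]:
  "\<zero>\<^bsub>group_algebra G\<^esub> \<otimes>\<^bsub>group_algebra G\<^esub> f = \<zero>\<^bsub>group_algebra G\<^esub>"
  "f \<otimes>\<^bsub>group_algebra G\<^esub> \<zero>\<^bsub>group_algebra G\<^esub> = \<zero>\<^bsub>group_algebra G\<^esub>"
  by (auto simp: group_algebra_def)

lemma group_algebra_zero_closed: "\<zero>\<^bsub>group_algebra G\<^esub> \<in> carrier (group_algebra G)"
  by (simp add: group_algebra_carrier group_algebra_zero)

text \<open>The \<open>k\<close>-vector space structure, written pointwise: then identities between linear combinations
  with few terms become identities in \<open>k\<close>.\<close>

definition ga_scale :: "'k::field \<Rightarrow> ('g \<Rightarrow> 'k) \<Rightarrow> 'g \<Rightarrow> 'k" where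
  "ga_scale a f = (\<lambda>x. a * f x)"

lemma ga_scale_1 [simp]: "ga_scale 1 f = f"
  and ga_scale_scale [simp]: "ga_scale a (ga_scale b f) = ga_scale (a * b) f"
  and ga_scale_single [simp]: "ga_scale a (ga_single g b) = ga_single g (a * b)"
  by (auto simp: ga_scale_def ga_single_def)

lemma ga_scale_0: "ga_scale 0 f = \<zero>\<^bsub>group_algebra G\<^esub>"
  and ga_scale_zero: "ga_scale a \<zero>\<^bsub>group_algebra G\<^esub> = \<zero>\<^bsub>group_algebra G\<^esub>"
  and ga_scale_add_left:
    "ga_scale (a + b) f = ga_scale a f \<oplus>\<^bsub>group_algebra G\<^esub> ga_scale b f"
  and ga_scale_add:
    "ga_scale a (f \<oplus>\<^bsub>group_algebra G\<^esub> h) = ga_scale a f \<oplus>\<^bsub>group_algebra G\<^esub> ga_scale a h"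
  by (auto simp: ga_scale_def group_algebra_add group_algebra_zero algebra_simps)

lemma ga_scale_closed [simp]:
  assumes "f \<in> carrier (group_algebra G)"
  shows "ga_scale a f \<in> carrier (group_algebra G)"
proof -
  have "{x. a * f x \<noteq> 0} \<subseteq> {x. f x \<noteq> 0}" by auto
  then show ?thesis
    using assms unfolding group_algebra_carrier ga_scale_def by (meson finite_subset order_trans)
qed

lemma ga_scale_mult:
  assumes "f \<in> carrier (group_algebra G)" "h \<in> carrier (group_algebra G)"
  shows "ga_scale a f \<otimes>\<^bsub>group_algebra G\<^esub> h = ga_scale a (f \<otimes>\<^bsub>group_algebra G\<^esub> h)"
    and "f \<otimes>\<^bsub>group_algebra G\<^esub> ga_scale a h = ga_scale a (f \<otimes>\<^bsub>group_algebra G\<^esub> h)"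
proof -
  let ?A = "{g. f g \<noteq> 0}" and ?B = "{g. h g \<noteq> 0}"
  have fin: "finite ?A" "finite ?B" using assms by (auto simp: group_algebra_carrier)
  have *: "(f' \<otimes>\<^bsub>group_algebra G\<^esub> h') x =
      (\<Sum>y\<in>?A. \<Sum>z\<in>?B. if y \<otimes>\<^bsub>G\<^esub> z = x then f' y * h' z else 0)"
    if "{g. f' g \<noteq> 0} \<subseteq> ?A" "{g. h' g \<noteq> 0} \<subseteq> ?B" for f' h' x
    using group_algebra_mult_apply[OF fin that] .
  show "ga_scale a f \<otimes>\<^bsub>group_algebra G\<^esub> h = ga_scale a (f \<otimes>\<^bsub>group_algebra G\<^esub> h)"
    by (auto simp: fun_eq_iff ga_scale_def * subset_iff sum_distrib_left mult.assoc
        intro!: sum.cong)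
  show "f \<otimes>\<^bsub>group_algebra G\<^esub> ga_scale a h = ga_scale a (f \<otimes>\<^bsub>group_algebra G\<^esub> h)"
    by (auto simp: fun_eq_iff ga_scale_def * subset_iff sum_distrib_left mult.left_commute
        intro!: sum.cong)
qed

context monoid
begin

lemma group_algebra_mult_closed:
  assumes "f \<in> carrier (group_algebra G)" "h \<in> carrier (group_algebra G)"
  shows "f \<otimes>\<^bsub>group_algebra G\<^esub> h \<in> carrier (group_algebra G)"
  using assms(1)
proof (induction f rule: group_algebra_induct)
  case zero
  show ?case by (simp only: group_algebra_mult_zero group_algebra_zero_closed)
next
  case (single g a)
  from assms(2) show ?case
  proof (induction h rule: group_algebra_induct)
    case zero
    show ?case by (simp only: group_algebra_mult_zero group_algebra_zero_closed)
  next
    case (single h b)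
    then show ?case using \<open>g \<in> carrier G\<close> by (simp add: ga_single_mult)
  next
    case (add h h')
    then show ?case
      using \<open>g \<in> carrier G\<close> by (metis group_algebra_r_distr group_algebra_add_closed ga_single_closed)
  qed
next
  case (add f f')
  then show ?case using assms(2) by (metis group_algebra_l_distr group_algebra_add_closed)
qed

lemma group_algebra_assoc:
  assumes f: "f \<in> carrier (group_algebra G)" and h: "h \<in> carrier (group_algebra G)"
    and k: "k \<in> carrier (group_algebra G)"
  shows "(f \<otimes>\<^bsub>group_algebra G\<^esub> h) \<otimes>\<^bsub>group_algebra G\<^esub> k =
    f \<otimes>\<^bsub>group_algebra G\<^esub> (h \<otimes>\<^bsub>group_algebra G\<^esub> k)"
proof -
  note closed = group_algebra_mult_closed group_algebra_add_closed ga_single_closed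
  note distr = group_algebra_l_distr group_algebra_r_distr
  have 1: "(ga_single x a \<otimes>\<^bsub>group_algebra G\<^esub> ga_single y b) \<otimes>\<^bsub>group_algebra G\<^esub> k =
    ga_single x a \<otimes>\<^bsub>group_algebra G\<^esub> (ga_single y b \<otimes>\<^bsub>group_algebra G\<^esub> k)"
    if xy: "x \<in> carrier G" "y \<in> carrier G" for x y a b
    using k
  proof (induction k rule: group_algebra_induct)
    case zero
    show ?case by (simp only: group_algebra_mult_zero)
  next
    case (single z c)
    then show ?case using xy by (simp add: ga_single_mult m_assoc mult.assoc)
  next
    case (add k k')
    then show ?case using xy by (simp only: distr closed)
  qed
  have 2: "(ga_single x a \<otimes>\<^bsub>group_algebra G\<^esub> h) \<otimes>\<^bsub>group_algebra G\<^esub> k =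
    ga_single x a \<otimes>\<^bsub>group_algebra G\<^esub> (h \<otimes>\<^bsub>group_algebra G\<^esub> k)"
    if x: "x \<in> carrier G" for x a
    using h
  proof (induction h rule: group_algebra_induct)
    case zero
    show ?case by (simp only: group_algebra_mult_zero)
  next
    case (single y b)
    then show ?case using 1 x by simp
  next
    case (add h h')
    then show ?case using x k by (simp only: distr closed)
  qed
  show ?thesis
    using f
  proof (induction f rule: group_algebra_induct)
    case zero
    show ?case by (simp only: group_algebra_mult_zero)
  next
    case (single x a)
    then show ?case using 2 by simp
  next
    case (add f f')
    then show ?case using h k by (simp only: distr closed)
  qed
qed

lemma group_algebra_one_mult:
  fixes f :: "'a \<Rightarrow> 'k::field"
  assumes "f \<in> carrier (group_algebra G)"
  shows "\<one>\<^bsub>group_algebra G\<^esub> \<otimes>\<^bsub>group_algebra G\<^esub> f = f"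
    and "f \<otimes>\<^bsub>group_algebra G\<^esub> \<one>\<^bsub>group_algebra G\<^esub> = f"
proof -
  have one: "\<one>\<^bsub>group_algebra G\<^esub> \<in> carrier (group_algebra G :: ('a \<Rightarrow> 'k) ring)"
    by (simp add: group_algebra_one)
  show "\<one>\<^bsub>group_algebra G\<^esub> \<otimes>\<^bsub>group_algebra G\<^esub> f = f"
    using assms
  proof (induction f rule: group_algebra_induct)
    case (add f f')
    then show ?case using one by (simp only: group_algebra_r_distr)
  qed (simp_all only: group_algebra_mult_zero, simp add: group_algebra_one ga_single_mult)
  show "f \<otimes>\<^bsub>group_algebra G\<^esub> \<one>\<^bsub>group_algebra G\<^esub> = f"
    using assms
  proof (induction f rule: group_algebra_induct)
    case (add f f')
    then show ?case using one by (simp only: group_algebra_l_distr)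
  qed (simp_all only: group_algebra_mult_zero, simp add: group_algebra_one ga_single_mult)
qed

lemma group_algebra_ring: "ring (group_algebra G :: ('a \<Rightarrow> 'k::field) ring)"
proof (rule ringI)
  show "abelian_group (group_algebra G :: ('a \<Rightarrow> 'k) ring)"
  proof (rule abelian_groupI)
    fix f :: "'a \<Rightarrow> 'k"
    assume "f \<in> carrier (group_algebra G)"
    then have "(\<lambda>x. - f x) \<in> carrier (group_algebra G)" by (simp add: group_algebra_carrier)
    then show "\<exists>h\<in>carrier (group_algebra G). h \<oplus>\<^bsub>group_algebra G\<^esub> f = \<zero>\<^bsub>group_algebra G\<^esub>"
      by (rule bexI[rotated]) (simp add: group_algebra_add group_algebra_zero)
  qed (simp_all only: group_algebra_add_closed group_algebra_zero_closed,
      simp_all add: group_algebra_add group_algebra_zero ac_simps)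
  show "monoid (group_algebra G :: ('a \<Rightarrow> 'k) ring)"
    by (rule monoidI)
      (simp_all only: group_algebra_mult_closed group_algebra_assoc group_algebra_one_mult,
        simp add: group_algebra_one)
qed (rule group_algebra_l_distr group_algebra_r_distr; assumption)+

lemma ga_single_one_mult:
  fixes f :: "'a \<Rightarrow> 'k::field"
  assumes "f \<in> carrier (group_algebra G)"
  shows "ga_single \<one> a \<otimes>\<^bsub>group_algebra G\<^esub> f = ga_scale a f"
proof -
  have "ga_single \<one> a = ga_scale a \<one>\<^bsub>group_algebra G\<^esub>"
    by (simp add: group_algebra_one)
  moreover have "\<one>\<^bsub>group_algebra G\<^esub> \<in> carrier (group_algebra G :: ('a \<Rightarrow> 'k) ring)"
    by (simp add: group_algebra_one)
  ultimately show ?thesis using assms by (simp add: ga_scale_mult group_algebra_one_mult)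
qed

end

section \<open>Left ideals generated by idempotents\<close>

lemma regular_module_simps [simp]:
  "carrier (regular_module R) = carrier R" "zero (regular_module R) = zero R"
  "add (regular_module R) = add R" "smult (regular_module R) = mult R"
  by (simp_all add: regular_module_def)

lemma left_ideal_module_simps [simp]:
  "carrier (left_ideal_module R e) = left_ideal_gen R e" "zero (left_ideal_module R e) = zero R"
  "add (left_ideal_module R e) = add R" "smult (left_ideal_module R e) = mult R"
  by (simp_all add: left_ideal_module_def)

context ring
begin

lemma left_ideal_gen_subset: "e \<in> carrier R \<Longrightarrow> left_ideal_gen R e \<subseteq> carrier R"
  by (auto simp: left_ideal_gen_def)

lemma left_ideal_gen_zero: "e \<in> carrier R \<Longrightarrow> \<zero> \<in> left_ideal_gen R e"
  unfolding left_ideal_gen_def by (force intro: exI[of _ \<zero>])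

lemma left_ideal_gen_add:
  "e \<in> carrier R \<Longrightarrow> x \<in> left_ideal_gen R e \<Longrightarrow> y \<in> left_ideal_gen R e \<Longrightarrow>
     x \<oplus> y \<in> left_ideal_gen R e"
  unfolding left_ideal_gen_def by clarify (metis l_distr a_closed)

lemma left_ideal_gen_minus:
  assumes "e \<in> carrier R" "x \<in> left_ideal_gen R e"
  shows "\<ominus> x \<in> left_ideal_gen R e"
proof -
  obtain a where "a \<in> carrier R" "x = a \<otimes> e" using assms(2) by (auto simp: left_ideal_gen_def)
  then have "\<ominus> x = (\<ominus> a) \<otimes> e" using assms(1) by (simp add: l_minus)
  then show ?thesis using \<open>a \<in> carrier R\<close> by (auto simp: left_ideal_gen_def)
qed

lemma left_ideal_gen_mult:
  "e \<in> carrier R \<Longrightarrow> a \<in> carrier R \<Longrightarrow> x \<in> left_ideal_gen R e \<Longrightarrow> a \<otimes> x \<in> left_ideal_gen R e"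
  unfolding left_ideal_gen_def by clarify (metis m_assoc m_closed)

lemma left_ideal_gen_idempotent:
  assumes "idempotent_elem R e" "x \<in> left_ideal_gen R e"
  shows "x \<otimes> e = x"
  using assms by (auto simp: left_ideal_gen_def idempotent_elem_def m_assoc)

text \<open>Negation in the underlying monoid has to be compared separately, because \<open>a_inv\<close> of a module
  record is a description operator applied to a different record.\<close>

lemma a_inv_regular_module: "m_inv (add_monoid (regular_module R)) x = \<ominus> x"
  by (simp add: a_inv_def m_inv_def)

lemma left_ideal_gen_submodule:
  assumes "e \<in> carrier R"
  shows "submodule (left_ideal_gen R e) R (regular_module R)"
proof (intro submodule.intro subgroup.intro submodule_axioms.intro)
  show "inv\<^bsub>add_monoid (regular_module R)\<^esub> x \<in> left_ideal_gen R e"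
    if "x \<in> left_ideal_gen R e" for x
    unfolding a_inv_regular_module using assms that by (rule left_ideal_gen_minus)
qed (use assms left_ideal_gen_subset left_ideal_gen_zero left_ideal_gen_add left_ideal_gen_mult
     in \<open>auto\<close>)

lemma regular_module_abelian: "abelian_group (regular_module R)"
proof (rule abelian_groupI)
  fix x assume "x \<in> carrier (regular_module R)"
  then show "\<exists>y\<in>carrier (regular_module R). y \<oplus>\<^bsub>regular_module R\<^esub> x = \<zero>\<^bsub>regular_module R\<^esub>"
    by (auto intro: bexI[of _ "\<ominus> x"] l_neg)
qed (auto simp: a_ac)

lemma left_ideal_left_module:
  assumes e: "e \<in> carrier R"
  shows "left_module R (left_ideal_module R e)"
proof (intro left_module.intro left_module_axioms.intro)
  show "ring R" by (rule ring_axioms)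
  show "abelian_group (left_ideal_module R e)"
  proof (rule abelian_groupI)
    fix x assume "x \<in> carrier (left_ideal_module R e)"
    then show "\<exists>y\<in>carrier (left_ideal_module R e).
        y \<oplus>\<^bsub>left_ideal_module R e\<^esub> x = \<zero>\<^bsub>left_ideal_module R e\<^esub>"
      using left_ideal_gen_minus[OF e] left_ideal_gen_subset[OF e] by (auto intro: bexI[of _ "\<ominus> x"] l_neg)
  qed (use e in \<open>auto simp: left_ideal_gen_subset[THEN subsetD] left_ideal_gen_add left_ideal_gen_zero a_ac\<close>)
qed (use e in \<open>auto simp: left_ideal_gen_subset[THEN subsetD] left_ideal_gen_mult l_distr r_distr m_assoc\<close>)

text \<open>Right multiplication by \<open>e\<close> is a retraction of the free module \<open>R\<close> onto \<open>R e\<close>; the index set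
  \<open>{e}\<close> makes \<open>R\<close> a free module of rank one.\<close>

lemma left_ideal_projective:
  assumes e: "idempotent_elem R e"
  shows "projective_left_module R (left_ideal_module R e)"
proof -
  have eR: "e \<in> carrier R" using e by (simp add: idempotent_elem_def)
  note in_R = subsetD[OF left_ideal_gen_subset[OF eR]]
  let ?F = "free_left_module R {e}"
  let ?j = "\<lambda>x i. if i = e then x else \<zero>" and ?p = "\<lambda>f. f e \<otimes> e"
  have fin: "finite {i. (if i = e then x else \<zero>) \<noteq> \<zero>}" for x
    by (rule finite_subset[of _ "{e}"]) auto
  have "?j \<in> left_module_hom R (left_ideal_module R e) ?F"
    using in_R fin by (auto simp: left_module_hom_def free_left_module_def)
  moreover have "?p \<in> left_module_hom R ?F (left_ideal_module R e)"
    using eR by (auto simp: left_module_hom_def free_left_module_def left_ideal_gen_def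
                     l_distr m_assoc)
  moreover have "\<forall>x\<in>carrier (left_ideal_module R e). ?p (?j x) = x"
    using left_ideal_gen_idempotent[OF e] by simp
  ultimately show ?thesis
    unfolding projective_left_module_def using left_ideal_left_module[OF eR] by blast
qed

lemma finsum_regular_module:
  assumes "finite I" "f \<in> I \<rightarrow> carrier R"
  shows "(\<Oplus>\<^bsub>regular_module R\<^esub>i\<in>I. f i) = (\<Oplus>i\<in>I. f i)"
proof -
  interpret M: abelian_group "regular_module R" by (rule regular_module_abelian)
  show ?thesis using assms
    by (induction I rule: finite_induct) (auto simp: M.finsum_insert Pi_def)
qed

text \<open>The component of \<open>x\<close> in \<open>R e\<^sub>i\<close> must be \<open>x e\<^sub>i\<close>: right multiplication by \<open>e\<^sub>i\<close> fixes \<open>R e\<^sub>i\<close> and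
  kills \<open>R e\<^sub>j\<close> for \<open>j \<noteq> i\<close>. These components add up to \<open>x\<close> because the \<open>e\<^sub>i\<close> add up to \<open>\<one>\<close>.\<close>

lemma internal_direct_sum_left_ideals:
  assumes I: "finite I"
    and idem: "\<And>i. i \<in> I \<Longrightarrow> idempotent_elem R (e i)"
    and orth: "\<And>i j. i \<in> I \<Longrightarrow> j \<in> I \<Longrightarrow> i \<noteq> j \<Longrightarrow> orthogonal_elems R (e i) (e j)"
    and one: "\<one> = (\<Oplus>i\<in>I. e i)"
  shows "internal_direct_sum R (regular_module R) I (\<lambda>i. left_ideal_gen R (e i))"
proof -
  have e: "e i \<in> carrier R" if "i \<in> I" for i using idem[OF that] by (simp add: idempotent_elem_def)
  note in_R = subsetD[OF left_ideal_gen_subset[OF e]]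
  have "\<exists>!f. f \<in> (\<Pi>\<^sub>E i\<in>I. left_ideal_gen R (e i)) \<and> x = (\<Oplus>\<^bsub>regular_module R\<^esub>i\<in>I. f i)"
    if x: "x \<in> carrier R" for x
  proof (rule ex1I)
    let ?f = "\<lambda>i\<in>I. x \<otimes> e i"
    have "(\<Oplus>\<^bsub>regular_module R\<^esub>i\<in>I. ?f i) = (\<Oplus>i\<in>I. ?f i)"
      using I x e by (intro finsum_regular_module) auto
    also have "\<dots> = (\<Oplus>i\<in>I. x \<otimes> e i)"
      using x e by (intro finsum_cong') auto
    also have "\<dots> = x \<otimes> (\<Oplus>i\<in>I. e i)"
      using I x e by (intro finsum_rdistr[symmetric]) auto
    finally show "?f \<in> (\<Pi>\<^sub>E i\<in>I. left_ideal_gen R (e i)) \<and> x = (\<Oplus>\<^bsub>regular_module R\<^esub>i\<in>I. ?f i)"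
      using x by (auto simp: one[symmetric] left_ideal_gen_def)
  next
    fix f assume f: "f \<in> (\<Pi>\<^sub>E i\<in>I. left_ideal_gen R (e i)) \<and> x = (\<Oplus>\<^bsub>regular_module R\<^esub>i\<in>I. f i)"
    then have fR: "f i \<in> carrier R" if "i \<in> I" for i using that in_R by blast
    have xf: "x = (\<Oplus>i\<in>I. f i)" using f fR I by (simp add: finsum_regular_module Pi_def)
    have "x \<otimes> e j = f j" if j: "j \<in> I" for j
    proof -
      have "f i \<otimes> e j = (if i = j then f i else \<zero>)" if i: "i \<in> I" for i
      proof -
        have *: "f i \<otimes> e i = f i"
          using f i idem[OF i] by (intro left_ideal_gen_idempotent) auto
        show ?thesis
        proof (cases "i = j")
          case False
          have "f i \<otimes> e j = f i \<otimes> (e i \<otimes> e j)" using * m_assoc fR e i j by metis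
          then show ?thesis using False orth i j fR by (simp add: orthogonal_elems_def)
        qed (use * in simp)
      qed
      moreover have "x \<otimes> e j = (\<Oplus>i\<in>I. f i \<otimes> e j)"
        unfolding xf using I fR e j by (intro finsum_ldistr) auto
      ultimately have "x \<otimes> e j = (\<Oplus>i\<in>I. if j = i then f i else \<zero>)"
        using fR by (auto intro: finsum_cong')
      also have "\<dots> = f j" using I fR j by (intro finsum_singleton) auto
      finally show ?thesis .
    qed
    then show "f = (\<lambda>i\<in>I. x \<otimes> e i)"
      using f by (auto intro: extensionalityI simp: PiE_def extensional_def)
  qed
  then show ?thesis
    using left_ideal_gen_submodule[OF e] by (simp add: internal_direct_sum_def)
qed

end

section \<open>Permutations in the alternating group of degree 4\<close>

definition v1 :: "nat \<Rightarrow> nat" where "v1 = cycle_of_list [1, 2] \<circ> cycle_of_list [3, 4]"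
definition v2 :: "nat \<Rightarrow> nat" where "v2 = cycle_of_list [1, 3] \<circ> cycle_of_list [2, 4]"
definition v3 :: "nat \<Rightarrow> nat" where "v3 = v1 \<circ> v2"

lemmas A4_perm_defs = c123_def c132_def v1_def v2_def v3_def

lemma A4_perm_apply:
  "c123 x = (if x = 1 then 2 else if x = 2 then 3 else if x = 3 then 1 else x)"
  "c132 x = (if x = 1 then 3 else if x = 2 then 1 else if x = 3 then 2 else x)"
  "v1 x = (if x = 1 then 2 else if x = 2 then 1 else if x = 3 then 4 else if x = 4 then 3 else x)"
  "v2 x = (if x = 1 then 3 else if x = 2 then 4 else if x = 3 then 1 else if x = 4 then 2 else x)"
  "v3 x = (if x = 1 then 4 else if x = 2 then 3 else if x = 3 then 2 else if x = 4 then 1 else x)"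
  by (simp_all add: A4_perm_defs transpose_def)

lemma A4_perm_rules [simp]:
  "c123 \<circ> c123 = c132" "c123 \<circ> c132 = id" "c132 \<circ> c123 = id" "c132 \<circ> c132 = c123"
  "v1 \<circ> v1 = id" "v1 \<circ> v2 = v3" "v1 \<circ> v3 = v2"
  "v2 \<circ> v1 = v3" "v2 \<circ> v2 = id" "v2 \<circ> v3 = v1"
  "v3 \<circ> v1 = v2" "v3 \<circ> v2 = v1" "v3 \<circ> v3 = id"
  by (auto simp: fun_eq_iff A4_perm_apply)

text \<open>Conjugation by the 3-cycle permutes the three involutions cyclically. The rules move elements
  of \<open>K3\<close> to the right, into the normal form \<open>v \<circ> k\<close> of \<open>A4_factorization\<close> below.\<close>

lemma A4_conj_rules [simp]:
  "c123 \<circ> v1 = v3 \<circ> c123" "c123 \<circ> v2 = v1 \<circ> c123" "c123 \<circ> v3 = v2 \<circ> c123"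
  "c132 \<circ> v1 = v2 \<circ> c132" "c132 \<circ> v2 = v3 \<circ> c132" "c132 \<circ> v3 = v1 \<circ> c132"
  by (auto simp: fun_eq_iff A4_perm_apply)

lemma c_distinct [simp]: "c123 \<noteq> id" "c132 \<noteq> id" "c123 \<noteq> c132"
  "id \<noteq> c123" "id \<noteq> c132" "c132 \<noteq> c123"
  by (auto simp: fun_eq_iff A4_perm_apply intro: exI[of _ 1])

lemma transpose_even_comp:
  assumes "a \<noteq> b" "c \<noteq> d"
  shows "evenperm (transpose a b \<circ> transpose c d)"
  using assms by (simp add: evenperm_comp permutation_swap_id evenperm_swap)

lemma A4_perm_closed [simp]:
  "id \<in> carrier A4" "c123 \<in> carrier A4" "c132 \<in> carrier A4"
  "v1 \<in> carrier A4" "v2 \<in> carrier A4" "v3 \<in> carrier A4"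
proof -
  interpret A4: group A4 by (rule alt_group_is_group)
  have comp: "g \<circ> h \<in> carrier A4" if "g \<in> carrier A4" "h \<in> carrier A4" for g h
    using A4.m_closed[OF that] by (simp add: alt_group_mult)
  have tr: "transpose a b \<circ> transpose c d \<in> carrier A4"
    if "{a, b, c, d} \<subseteq> {1..4}" "a \<noteq> b" "c \<noteq> d" for a b c d
    using that by (auto simp: alt_group_carrier transpose_even_comp
      intro!: permutes_compose permutes_swap_id)
  show "id \<in> carrier A4" using A4.one_closed by (simp add: alt_group_one)
  show c: "c123 \<in> carrier A4" unfolding c123_def by (simp add: tr)
  show "c132 \<in> carrier A4" using comp[OF c c] by simp
  show v: "v1 \<in> carrier A4" "v2 \<in> carrier A4" unfolding v1_def v2_def by (simp_all add: tr)
  show "v3 \<in> carrier A4" unfolding v3_def by (rule comp[OF v])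
qed

lemma V4_elems: "v1 \<in> V4" "v2 \<in> V4" "v3 \<in> V4"
proof -
  show v: "v1 \<in> V4" "v2 \<in> V4"
    unfolding V4_def v1_def v2_def by (auto intro: generate.incl)
  have "v1 \<otimes>\<^bsub>A4\<^esub> v2 \<in> V4"
    using v unfolding V4_def by (rule generate.eng)
  then show "v3 \<in> V4" by (simp add: alt_group_mult)
qed

lemma K3_eq: "K3 = {id, c123, c132}"
proof
  interpret A4: group A4 by (rule alt_group_is_group)
  have inv: "inv\<^bsub>A4\<^esub> c123 = c132"
    by (rule A4.inv_equality) (simp_all add: alt_group_mult alt_group_one)
  show "K3 \<subseteq> {id, c123, c132}"
  proof
    fix x assume "x \<in> K3"
    then show "x \<in> {id, c123, c132}" unfolding K3_def
    proof (induction rule: generate.induct)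
      case (eng g h)
      then show ?case
        by (elim insertE emptyE) (simp_all only: alt_group_mult A4_perm_rules insert_iff simp_thms id_comp comp_id)
    qed (auto simp: inv alt_group_one)
  qed
  show "{id, c123, c132} \<subseteq> K3"
    using generate.one[of A4 "{c123}"] generate.incl[of c123 "{c123}" A4]
      generate.inv[of c123 "{c123}" A4]
    by (auto simp: K3_def inv alt_group_one)
qed

text \<open>\<open>V4\<close> is transitive on the four points, so \<open>v\<close> can be chosen to make \<open>v \<circ> g\<close> fix 4. The group
  \<open>K3\<close> is transitive on the other three points, so some \<open>k' \<in> K3\<close> makes \<open>k' \<circ> v \<circ> g\<close> fix 1 as well. An even
  permutation of the two remaining points is the identity.\<close>

lemma A4_factorization:
  assumes g: "g \<in> carrier A4"
  obtains v k where "v \<in> {id, v1, v2, v3}" "k \<in> {id, c123, c132}" "g = v \<circ> k"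
proof -
  interpret A4: group A4 by (rule alt_group_is_group)
  have comp: "g \<circ> h \<in> carrier A4" if "g \<in> carrier A4" "h \<in> carrier A4" for g h
    using A4.m_closed[OF that] by (simp add: alt_group_mult)
  have perm: "h permutes {1..4}" if "h \<in> carrier A4" for h
    using that by (simp add: alt_group_carrier)
  have range: "h x \<in> {1, 2, 3, 4}" if "h \<in> carrier A4" "x \<in> {1, 2, 3, 4}" for h x
    using permutes_in_image[OF perm[OF that(1)], of x] that(2) by auto
  have "g 4 \<in> {1, 2, 3, 4}" using range[OF g] by simp
  then have "\<exists>v\<in>{id, v1, v2, v3}. v (g 4) = 4"
    by (elim insertE emptyE) (simp_all add: A4_perm_apply)
  then obtain v where v: "v \<in> {id, v1, v2, v3}" "v (g 4) = 4"
    by blast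
  define h where "h = v \<circ> g"
  have h: "h \<in> carrier A4" "h 4 = 4" using v g comp unfolding h_def by auto
  have "h 1 \<noteq> h 4" using permutes_inj[OF perm[OF h(1)]] by (simp add: inj_eq)
  then have "h 1 \<in> {1, 2, 3}" using range[OF h(1), of 1] h(2) by auto
  then have "\<exists>k'\<in>{id, c123, c132}. k' (h 1) = 1"
    by (elim insertE emptyE) (simp_all add: A4_perm_apply)
  then obtain k' where k': "k' \<in> {id, c123, c132}" "k' (h 1) = 1"
    by blast
  define q where "q = k' \<circ> h"
  have "k' 4 = 4" using k'(1) by (auto simp: A4_perm_apply)
  then have q: "q \<in> carrier A4" "q 1 = 1" "q 4 = 4"
    using k' h comp unfolding q_def by auto
  have "q permutes {2, 3}"
    by (rule permutes_superset[OF perm[OF q(1)]]) (use q in \<open>auto simp: atLeastAtMost_iff le_Suc_eq numeral_eq_Suc\<close>)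
  then have "q = id \<or> q = transpose 2 3" by (simp add: permutes_doubleton_iff)
  moreover have "q \<noteq> transpose 2 3"
    using q(1) evenperm_swap[of "2::nat" 3] by (auto simp: alt_group_carrier)
  ultimately have q_id: "k' \<circ> (v \<circ> g) = id" by (simp add: q_def h_def)
  have "\<exists>k\<in>{id, c123, c132}. k \<circ> k' = id"
    using k'(1) by (elim insertE emptyE) simp_all
  then obtain k where k: "k \<in> {id, c123, c132}" "k \<circ> k' = id" by blast
  have vv: "v \<circ> v = id" using v(1) by auto
  have "g = (v \<circ> (k \<circ> k') \<circ> v) \<circ> g" by (simp add: k(2) vv)
  also have "\<dots> = v \<circ> k \<circ> (k' \<circ> (v \<circ> g))" by (simp add: comp_assoc)
  finally have "g = v \<circ> k" by (simp add: q_id)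
  then show thesis using that v(1) k(1) by blast
qed

section \<open>The idempotents and their corners\<close>

interpretation kA4: ring "kA4 :: ((nat \<Rightarrow> nat) \<Rightarrow> 'k::field) ring"
proof -
  interpret A4: group A4 by (rule alt_group_is_group)
  show "ring (kA4 :: ((nat \<Rightarrow> nat) \<Rightarrow> 'k) ring)" by (rule A4.group_algebra_ring)
qed

lemma kA4_single_mult [simp]:
  "ga_single g a \<otimes>\<^bsub>kA4\<^esub> ga_single h b = ga_single (g \<circ> h) (a * b)"
  by (simp add: ga_single_mult alt_group_mult)

lemma A4_comp_closed [simp]: "g \<in> carrier A4 \<Longrightarrow> h \<in> carrier A4 \<Longrightarrow> g \<circ> h \<in> carrier A4"
  using group.is_monoid[OF alt_group_is_group, THEN monoid.m_closed, of g 4 h]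
  by (simp add: alt_group_mult)

lemma kA4_one: "\<one>\<^bsub>kA4\<^esub> = ga_single id 1"
  by (simp add: group_algebra_one alt_group_one)

lemma kA4_single_id_mult:
  assumes "f \<in> carrier kA4"
  shows "ga_single id a \<otimes>\<^bsub>kA4\<^esub> f = ga_scale a f"
proof -
  interpret A4: group A4 by (rule alt_group_is_group)
  show ?thesis using A4.ga_single_one_mult[OF assms] by (simp add: alt_group_one)
qed

text \<open>For a cube root of unity \<open>\<chi>\<close>, this is the usual idempotent of \<open>k K3\<close> attached to a character of \<open>K3\<close>;
  its factor \<open>1 / 3\<close> is 1 in characteristic 2. It is parametrised by \<open>\<chi>\<close> rather than by an index so that the three idempotents are treated uniformly;
  \<open>K3\<close> acts on it through the character sending \<open>c123\<close> to \<open>\<chi>\<^sup>2 = 1 / \<chi>\<close>.\<close>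

definition K3_idem :: "'k::field \<Rightarrow> (nat \<Rightarrow> nat) \<Rightarrow> 'k" where
  "K3_idem \<chi> = ga_single id 1 \<oplus>\<^bsub>kA4\<^esub> ga_single c123 \<chi> \<oplus>\<^bsub>kA4\<^esub> ga_single c132 (\<chi>^2)"

definition V4_sum :: "(nat \<Rightarrow> nat) \<Rightarrow> 'k::field" where
  "V4_sum = ga_single v1 1 \<oplus>\<^bsub>kA4\<^esub> ga_single v2 1 \<oplus>\<^bsub>kA4\<^esub> ga_single v3 1"

lemma K3_idem_closed [simp]: "K3_idem \<chi> \<in> carrier kA4" and V4_sum_closed [simp]: "V4_sum \<in> carrier kA4"
  by (simp_all add: K3_idem_def V4_sum_def)

lemma K3_idem_id: "K3_idem \<chi> id = 1"
  by (simp add: K3_idem_def group_algebra_add ga_single_def)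

lemma K3_idem_nonzero: "K3_idem \<chi> \<noteq> \<zero>\<^bsub>kA4\<^esub>"
  using K3_idem_id[of \<chi>] by (auto simp: group_algebra_zero)

lemmas A4_calc = kA4.l_distr kA4.r_distr ga_scale_add[where G = A4] kA4.a_ac

text \<open>The sum runs over a conjugacy class of \<open>A4\<close>, so it is central in the group algebra.\<close>

lemma V4_sum_K3_idem_commute: "V4_sum \<otimes>\<^bsub>kA4\<^esub> K3_idem \<chi> = K3_idem \<chi> \<otimes>\<^bsub>kA4\<^esub> V4_sum"
  by (simp add: K3_idem_def V4_sum_def A4_calc)

context
  assumes char: "CHAR('k::field) = 2"
begin

lemma two_eq_zero: "(2::'k) = 0" and three_eq_one: "(3::'k) = 1"
proof -
  show "(2::'k) = 0" using of_nat_CHAR[where 'a = 'k] char by simp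
  moreover have "(3::'k) = 2 + 1" by simp
  ultimately show "(3::'k) = 1" by (simp only: add_0)
qed

text \<open>Three of the nine products are the identity, and each involution arises from two others, so
  the square is \<open>3 + 2 (v1 + v2 + v3)\<close>, which is 1 in characteristic 2.\<close>

lemma V4_sum_square: "V4_sum \<otimes>\<^bsub>kA4\<^esub> V4_sum = (\<one>\<^bsub>kA4\<^esub> :: (nat \<Rightarrow> nat) \<Rightarrow> 'k)"
proof
  fix x
  show "(V4_sum \<otimes>\<^bsub>kA4\<^esub> V4_sum) x = (\<one>\<^bsub>kA4\<^esub> x :: 'k)"
    unfolding V4_sum_def
    by (simp add: kA4.l_distr kA4.r_distr kA4_one)
      (simp add: group_algebra_add two_eq_zero three_eq_one)
qed

context
  fixes \<chi> :: "'k::field"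
  assumes chi: "\<chi>^3 = 1"
begin

lemma chi_rules: "\<chi> * \<chi>^2 = 1" "\<chi>^2 * \<chi> = 1" "\<chi>^2 * \<chi>^2 = \<chi>"
  "\<chi> * (\<chi>^2 * a) = a" "\<chi>^2 * (\<chi> * a) = a" "\<chi> * (a * \<chi>^2) = a" "\<chi>^2 * (a * \<chi>^2) = \<chi> * a"
  "\<chi> * (\<chi> * a) = a * \<chi>^2" "a * \<chi>^4 = \<chi> * a" "\<chi>^4 = \<chi>"
proof -
  show "\<chi> * (\<chi> * a) = a * \<chi>^2" by (simp add: power2_eq_square mult_ac)
  show 3: "\<chi> * \<chi>^2 = 1" "\<chi>^2 * \<chi> = 1"
    using chi by (simp_all add: power2_eq_square power3_eq_cube mult_ac)
  show "\<chi> * (\<chi>^2 * a) = a" "\<chi>^2 * (\<chi> * a) = a" "\<chi> * (a * \<chi>^2) = a"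
    using 3 by (metis mult.assoc mult.commute mult_1)+
  have "\<chi>^4 = \<chi>^3 * \<chi>" by (simp add: power_numeral_reduce mult_ac)
  then show 4: "\<chi>^4 = \<chi>" using chi by simp
  then show "a * \<chi>^4 = \<chi> * a" by simp
  show 5: "\<chi>^2 * \<chi>^2 = \<chi>" using 4 by (simp flip: power_add)
  show "\<chi>^2 * (a * \<chi>^2) = \<chi> * a"
    by (metis 5 mult.assoc mult.commute)
qed

lemma K_act_left:
  "ga_single c123 a \<otimes>\<^bsub>kA4\<^esub> K3_idem \<chi> = ga_scale (\<chi>^2 * a) (K3_idem \<chi>)"
  "ga_single c132 a \<otimes>\<^bsub>kA4\<^esub> K3_idem \<chi> = ga_scale (\<chi> * a) (K3_idem \<chi>)"
  "ga_single id a \<otimes>\<^bsub>kA4\<^esub> K3_idem \<chi> = ga_scale a (K3_idem \<chi>)"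
  by (simp_all add: K3_idem_def A4_calc chi_rules mult_ac)

lemma K_act_right:
  "K3_idem \<chi> \<otimes>\<^bsub>kA4\<^esub> ga_single c123 a = ga_scale (\<chi>^2 * a) (K3_idem \<chi>)"
  "K3_idem \<chi> \<otimes>\<^bsub>kA4\<^esub> ga_single c132 a = ga_scale (\<chi> * a) (K3_idem \<chi>)"
  "K3_idem \<chi> \<otimes>\<^bsub>kA4\<^esub> ga_single id a = ga_scale a (K3_idem \<chi>)"
  by (simp_all add: K3_idem_def A4_calc chi_rules mult_ac)

text \<open>As \<open>K3_idem \<chi>\<close> is an eigenvector of \<open>K3\<close>, left multiplication by \<open>K3_idem \<psi>\<close> is multiplication by
  \<open>1 + t + t\<^sup>2\<close> where \<open>t = \<psi> \<chi>\<^sup>2\<close>. If \<open>\<psi>\<close> is a cube root of unity too, this is 3, hence 1, for \<open>\<psi> = \<chi>\<close>, and 0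
  otherwise.\<close>

lemma K3_idem_mult:
  "K3_idem \<psi> \<otimes>\<^bsub>kA4\<^esub> K3_idem \<chi> = ga_scale (1 + \<psi> * \<chi>^2 + (\<psi> * \<chi>^2)^2) (K3_idem \<chi>)"
proof -
  have "(\<psi> * \<chi>^2)^2 = \<chi> * \<psi>^2" by (simp add: power_mult_distrib chi_rules flip: power_mult)
  then show ?thesis
    unfolding K3_idem_def[of \<psi>] ga_scale_add_left[where G = A4]
    by (simp add: kA4.l_distr K_act_left mult.commute)
qed

lemma K3_idem_idem: "K3_idem \<chi> \<otimes>\<^bsub>kA4\<^esub> K3_idem \<chi> = K3_idem \<chi>"
  using K3_idem_mult[of \<chi>] by (simp add: chi_rules three_eq_one)

lemma K3_idem_orthogonal:
  assumes psi: "\<psi>^3 = 1" and neq: "\<psi> \<noteq> \<chi>"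
  shows "K3_idem \<psi> \<otimes>\<^bsub>kA4\<^esub> K3_idem \<chi> = \<zero>\<^bsub>kA4\<^esub>"
proof -
  let ?t = "\<psi> * \<chi>^2"
  have "?t \<noteq> 1"
  proof
    assume "?t = 1"
    then have "\<chi> = \<psi> * \<chi>^3" by (simp add: power3_eq_cube power2_eq_square mult_ac)
    then show False using chi neq by simp
  qed
  have "?t^3 = (\<psi>^3) * (\<chi>^3)^2" by (simp add: power_mult_distrib flip: power_mult)
  then have "?t^3 = 1" using chi psi by simp
  then have "(?t - 1) * (1 + ?t + ?t^2) = 0" by (simp add: algebra_simps power2_eq_square power3_eq_cube)
  then have "1 + ?t + ?t^2 = 0" using \<open>?t \<noteq> 1\<close> by simp
  then show ?thesis
    unfolding K3_idem_mult by (simp add: ga_scale_0[where G = A4])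
qed

lemma V4_K3_act:
  assumes "v \<in> carrier A4"
  shows "ga_single (v \<circ> c123) a \<otimes>\<^bsub>kA4\<^esub> K3_idem \<chi> = ga_single v (\<chi>^2 * a) \<otimes>\<^bsub>kA4\<^esub> K3_idem \<chi>"
    and "ga_single (v \<circ> c132) a \<otimes>\<^bsub>kA4\<^esub> K3_idem \<chi> = ga_single v (\<chi> * a) \<otimes>\<^bsub>kA4\<^esub> K3_idem \<chi>"
proof -
  have *: "ga_single (v \<circ> k) a \<otimes>\<^bsub>kA4\<^esub> K3_idem \<chi> = ga_single v (b * a) \<otimes>\<^bsub>kA4\<^esub> K3_idem \<chi>"
    if "k \<in> carrier A4" "ga_single k 1 \<otimes>\<^bsub>kA4\<^esub> K3_idem \<chi> = ga_scale b (K3_idem \<chi>)" for k b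
  proof -
    have "ga_single (v \<circ> k) a \<otimes>\<^bsub>kA4\<^esub> K3_idem \<chi> =
        ga_single v a \<otimes>\<^bsub>kA4\<^esub> (ga_single k 1 \<otimes>\<^bsub>kA4\<^esub> K3_idem \<chi>)"
      using assms that(1) by (simp flip: kA4.m_assoc)
    also have "\<dots> = ga_scale b (ga_single v a) \<otimes>\<^bsub>kA4\<^esub> K3_idem \<chi>"
      unfolding that(2) using assms by (simp add: ga_scale_mult del: ga_scale_single)
    finally show ?thesis by simp
  qed
  show "ga_single (v \<circ> c123) a \<otimes>\<^bsub>kA4\<^esub> K3_idem \<chi> = ga_single v (\<chi>^2 * a) \<otimes>\<^bsub>kA4\<^esub> K3_idem \<chi>"
    "ga_single (v \<circ> c132) a \<otimes>\<^bsub>kA4\<^esub> K3_idem \<chi> = ga_single v (\<chi> * a) \<otimes>\<^bsub>kA4\<^esub> K3_idem \<chi>"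
    by (rule *; simp add: K_act_left)+
qed

text \<open>Moving \<open>v\<close> to the left through \<open>K3_idem \<chi>\<close> replaces it by its three conjugates under \<open>K3\<close>, while the
  elements of \<open>K3\<close> so freed are absorbed by the other factor \<open>K3_idem \<chi>\<close>.\<close>

lemma corner_V4:
  assumes "v \<in> {v1, v2, v3}"
  shows "K3_idem \<chi> \<otimes>\<^bsub>kA4\<^esub> (ga_single v a \<otimes>\<^bsub>kA4\<^esub> K3_idem \<chi>) = ga_scale a (V4_sum \<otimes>\<^bsub>kA4\<^esub> K3_idem \<chi>)"
proof -
  have expand: "K3_idem \<chi> \<otimes>\<^bsub>kA4\<^esub> ga_single v a = ga_single v a \<oplus>\<^bsub>kA4\<^esub>
      ga_single (c123 \<circ> v) (\<chi> * a) \<oplus>\<^bsub>kA4\<^esub> ga_single (c132 \<circ> v) (\<chi>^2 * a)"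
    using assms by (auto simp: K3_idem_def kA4.l_distr)
  have "K3_idem \<chi> \<otimes>\<^bsub>kA4\<^esub> (ga_single v a \<otimes>\<^bsub>kA4\<^esub> K3_idem \<chi>) =
      (K3_idem \<chi> \<otimes>\<^bsub>kA4\<^esub> ga_single v a) \<otimes>\<^bsub>kA4\<^esub> K3_idem \<chi>"
    using assms by (auto simp: kA4.m_assoc)
  also have "\<dots> = (ga_single v1 a \<oplus>\<^bsub>kA4\<^esub> ga_single v2 a \<oplus>\<^bsub>kA4\<^esub> ga_single v3 a) \<otimes>\<^bsub>kA4\<^esub> K3_idem \<chi>"
    unfolding expand using assms by (auto simp: kA4.l_distr V4_K3_act chi_rules kA4.a_ac)
  also have "\<dots> = ga_scale a V4_sum \<otimes>\<^bsub>kA4\<^esub> K3_idem \<chi>"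
    by (simp add: V4_sum_def ga_scale_add[where G = A4])
  finally show ?thesis by (simp add: ga_scale_mult)
qed

text \<open>The corner \<open>e kA4 e\<close> at \<open>e = K3_idem \<chi>\<close> is spanned by \<open>e\<close> and \<open>V4_sum e\<close>. On a basis element \<open>v \<circ> k\<close> the factor
  \<open>k\<close> becomes a scalar, and \<open>v\<close> contributes \<open>e\<close> if \<open>v = 1\<close> and \<open>V4_sum e\<close> otherwise.\<close>

lemma corner_element:
  assumes "a \<in> carrier kA4"
  obtains \<alpha> \<beta> where "K3_idem \<chi> \<otimes>\<^bsub>kA4\<^esub> (a \<otimes>\<^bsub>kA4\<^esub> K3_idem \<chi>) =
    ga_scale \<alpha> (K3_idem \<chi>) \<oplus>\<^bsub>kA4\<^esub> ga_scale \<beta> (V4_sum \<otimes>\<^bsub>kA4\<^esub> K3_idem \<chi>)"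
proof -
  let ?e = "K3_idem \<chi>" and ?z = "V4_sum \<otimes>\<^bsub>kA4\<^esub> K3_idem \<chi>"
  define W where "W = {ga_scale \<alpha> ?e \<oplus>\<^bsub>kA4\<^esub> ga_scale \<beta> ?z | \<alpha> \<beta>. True}"
  have scale_e: "ga_scale \<alpha> ?e \<in> W" for \<alpha>
  proof -
    have "ga_scale \<alpha> ?e = ga_scale \<alpha> ?e \<oplus>\<^bsub>kA4\<^esub> ga_scale 0 ?z"
      by (simp add: ga_scale_0[where G = A4])
    then show ?thesis unfolding W_def by blast
  qed
  have scale_z: "ga_scale \<beta> ?z \<in> W" for \<beta>
  proof -
    have "ga_scale \<beta> ?z = ga_scale 0 ?e \<oplus>\<^bsub>kA4\<^esub> ga_scale \<beta> ?z"
      by (simp add: ga_scale_0[where G = A4])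
    then show ?thesis unfolding W_def by blast
  qed
  have W_add: "x \<oplus>\<^bsub>kA4\<^esub> y \<in> W" if "x \<in> W" "y \<in> W" for x y
  proof -
    from that obtain a b c d where "x = ga_scale a ?e \<oplus>\<^bsub>kA4\<^esub> ga_scale b ?z"
      "y = ga_scale c ?e \<oplus>\<^bsub>kA4\<^esub> ga_scale d ?z"
      unfolding W_def by blast
    then have "x \<oplus>\<^bsub>kA4\<^esub> y = ga_scale (a + c) ?e \<oplus>\<^bsub>kA4\<^esub> ga_scale (b + d) ?z"
      by (simp add: ga_scale_add_left[where G = A4] kA4.a_ac)
    then show ?thesis unfolding W_def by blast
  qed
  have "?e \<otimes>\<^bsub>kA4\<^esub> (a \<otimes>\<^bsub>kA4\<^esub> ?e) \<in> W"
    using assms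
  proof (induction a rule: group_algebra_induct)
    case zero
    then show ?case using scale_e[of 0] by (simp add: ga_scale_0[where G = A4])
  next
    case (single g a)
    obtain v k where v: "v \<in> {id, v1, v2, v3}" and k: "k \<in> {id, c123, c132}" and g: "g = v \<circ> k"
      using A4_factorization[OF single] .
    have "v \<in> carrier A4" using v by auto
    then have "\<exists>b. ga_single g a \<otimes>\<^bsub>kA4\<^esub> ?e = ga_single v b \<otimes>\<^bsub>kA4\<^esub> ?e"
      using k V4_K3_act[of v a] unfolding g by (elim insertE emptyE; simp) blast+
    then obtain b where b: "ga_single g a \<otimes>\<^bsub>kA4\<^esub> ?e = ga_single v b \<otimes>\<^bsub>kA4\<^esub> ?e"
      by blast
    show ?case
    proof (cases "v = id")
      case True
      then show ?thesis unfolding b by (simp add: K_act_left ga_scale_mult K3_idem_idem scale_e)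
    next
      case False
      then have "v \<in> {v1, v2, v3}" using v by blast
      then show ?thesis unfolding b using corner_V4 scale_z by simp
    qed
  next
    case (add f h)
    then show ?case by (simp add: kA4.l_distr kA4.r_distr W_add)
  qed
  then show thesis using that unfolding W_def by blast
qed

text \<open>The corner is commutative of characteristic 2, so squaring is additive; it sends both
  spanning elements to \<open>K3_idem \<chi>\<close>. In particular an element of the corner is a unit or squares to zero.\<close>

lemma corner_square:
  assumes x: "x = ga_scale \<alpha> (K3_idem \<chi>) \<oplus>\<^bsub>kA4\<^esub> ga_scale \<beta> (V4_sum \<otimes>\<^bsub>kA4\<^esub> K3_idem \<chi>)"
  shows "x \<otimes>\<^bsub>kA4\<^esub> x = ga_scale ((\<alpha> + \<beta>)^2) (K3_idem \<chi>)"
proof -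
  let ?e = "K3_idem \<chi>" and ?z = "V4_sum \<otimes>\<^bsub>kA4\<^esub> K3_idem \<chi>"
  have ze: "?z \<otimes>\<^bsub>kA4\<^esub> ?e = ?z"
    unfolding kA4.m_assoc[OF V4_sum_closed K3_idem_closed K3_idem_closed] K3_idem_idem ..
  have ez: "?e \<otimes>\<^bsub>kA4\<^esub> ?z = ?z"
    unfolding kA4.m_assoc[OF K3_idem_closed V4_sum_closed K3_idem_closed, symmetric]
      V4_sum_K3_idem_commute[symmetric] by (rule ze)
  have "?z \<otimes>\<^bsub>kA4\<^esub> ?z = V4_sum \<otimes>\<^bsub>kA4\<^esub> (?e \<otimes>\<^bsub>kA4\<^esub> ?z)"
    by (intro kA4.m_assoc) simp_all
  also have "\<dots> = (V4_sum \<otimes>\<^bsub>kA4\<^esub> V4_sum) \<otimes>\<^bsub>kA4\<^esub> ?e" unfolding ez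
    by (intro kA4.m_assoc[symmetric]) simp_all
  finally have zz: "?z \<otimes>\<^bsub>kA4\<^esub> ?z = ?e" by (simp add: V4_sum_square)
  have "x \<otimes>\<^bsub>kA4\<^esub> x = ga_scale (\<alpha> * \<alpha>) ?e \<oplus>\<^bsub>kA4\<^esub> ga_scale (\<alpha> * \<beta>) ?z \<oplus>\<^bsub>kA4\<^esub>
      (ga_scale (\<alpha> * \<beta>) ?z \<oplus>\<^bsub>kA4\<^esub> ga_scale (\<beta> * \<beta>) ?e)"
    unfolding x
    by (simp add: kA4.l_distr kA4.r_distr ga_scale_mult K3_idem_idem ze ez zz mult.commute kA4.a_ac
        ga_scale_add[where G = A4])
  also have "\<dots> = ga_scale ((\<alpha> + \<beta>)^2) ?e"
    by (rule ext) (simp add: group_algebra_add ga_scale_def power2_sum power2_eq_square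
        algebra_simps two_eq_zero)
  finally show ?thesis .
qed

text \<open>If \<open>e = a + b\<close> with orthogonal idempotents, then \<open>a\<close> lies in the corner, so \<open>a = a\<^sup>2\<close> is a scalar
  multiple of \<open>e\<close>; a nonzero multiple leaves no room for \<open>b\<close>.\<close>

lemma K3_idem_primitive: "primitive_idempotent kA4 (K3_idem \<chi>)"
proof -
  let ?e = "K3_idem \<chi>"
  have False if ab: "idempotent_elem kA4 a" "idempotent_elem kA4 b" "a \<noteq> \<zero>\<^bsub>kA4\<^esub>" "b \<noteq> \<zero>\<^bsub>kA4\<^esub>"
    "orthogonal_elems kA4 a b" "?e = a \<oplus>\<^bsub>kA4\<^esub> b" for a b
  proof -
    have A: "a \<in> carrier kA4" "b \<in> carrier kA4" "a \<otimes>\<^bsub>kA4\<^esub> a = a" "b \<otimes>\<^bsub>kA4\<^esub> b = b"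
      "a \<otimes>\<^bsub>kA4\<^esub> b = \<zero>\<^bsub>kA4\<^esub>" "b \<otimes>\<^bsub>kA4\<^esub> a = \<zero>\<^bsub>kA4\<^esub>"
      using ab by (auto simp: idempotent_elem_def orthogonal_elems_def)
    have "?e \<otimes>\<^bsub>kA4\<^esub> (a \<otimes>\<^bsub>kA4\<^esub> ?e) = a" and eb: "?e \<otimes>\<^bsub>kA4\<^esub> b = b"
      unfolding ab(6) using A by (simp_all add: kA4.l_distr kA4.r_distr)
    then obtain \<alpha> \<beta> where "a = ga_scale \<alpha> ?e \<oplus>\<^bsub>kA4\<^esub> ga_scale \<beta> (V4_sum \<otimes>\<^bsub>kA4\<^esub> ?e)"
      using corner_element[OF A(1)] by metis
    then have a: "a = ga_scale ((\<alpha> + \<beta>)^2) ?e" (is "_ = ga_scale ?t _")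
      using corner_square A(3) by metis
    have "?t \<noteq> 0" using ab(3) a by (metis ga_scale_0)
    have "\<zero>\<^bsub>kA4\<^esub> = ga_scale ?t b"
      using A(2,5) eb unfolding a by (simp add: ga_scale_mult)
    then have "ga_scale (inverse ?t) \<zero>\<^bsub>kA4\<^esub> = b"
      using \<open>?t \<noteq> 0\<close> by simp
    then show False using ab(4) by (simp add: ga_scale_zero[where G = A4])
  qed
  then show ?thesis
    using K3_idem_nonzero K3_idem_idem by (auto simp: primitive_idempotent_def idempotent_elem_def)
qed

end
end

section \<open>Primitive idempotents of the subalgebra of the cyclic subgroup\<close>

text \<open>The operations of a group algebra do not refer to the carrier of the group, so computations in
  \<open>kK\<close> are computations in \<open>kA4\<close>.\<close>

lemma kK_simps:
  "mult kK = mult kA4" "zero kK = zero kA4" "one kK = one kA4" "add kK = add kA4"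
  by (simp_all add: group_algebra_def)

lemma kK_carrier_subset: "f \<in> carrier kK \<Longrightarrow> f \<in> carrier kA4"
  by (auto simp: group_algebra_carrier K3_eq)

lemma K3_idem_in_kK: "K3_idem \<chi> \<in> carrier kK"
proof -
  have "ga_single g a \<in> carrier kK" if "g \<in> {id, c123, c132}" for g and a :: 'a
    using that by (intro ga_single_closed) (simp add: K3_eq)
  then have "ga_single id 1 \<oplus>\<^bsub>kK\<^esub> ga_single c123 \<chi> \<oplus>\<^bsub>kK\<^esub> ga_single c132 (\<chi>^2) \<in> carrier kK"
    by (intro group_algebra_add_closed) simp_all
  then show ?thesis unfolding K3_idem_def kK_simps .
qed

context
  fixes \<chi> :: "'k::field"
  assumes char: "CHAR('k) = 2" and chi: "\<chi>^3 = 1"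
begin

lemma kK_act:
  assumes "x \<in> carrier kK"
  obtains s where "x \<otimes>\<^bsub>kA4\<^esub> K3_idem \<chi> = ga_scale s (K3_idem \<chi>)" "K3_idem \<chi> \<otimes>\<^bsub>kA4\<^esub> x = ga_scale s (K3_idem \<chi>)"
proof -
  have "\<exists>s. x \<otimes>\<^bsub>kA4\<^esub> K3_idem \<chi> = ga_scale s (K3_idem \<chi>) \<and> K3_idem \<chi> \<otimes>\<^bsub>kA4\<^esub> x = ga_scale s (K3_idem \<chi>)"
    using assms
  proof (induction x rule: group_algebra_induct)
    case zero
    show ?case unfolding kK_simps
      by (intro exI[of _ 0]) (simp add: ga_scale_0[where G = A4])
  next
    case (single g a)
    then have "g \<in> {id, c123, c132}" by (simp add: K3_eq)
    then show ?case
      by (elim insertE emptyE; simp only: K_act_left[OF char chi] K_act_right[OF char chi]) blast+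
  next
    case (add f h)
    then obtain s t where
      "f \<otimes>\<^bsub>kA4\<^esub> K3_idem \<chi> = ga_scale s (K3_idem \<chi>)" "K3_idem \<chi> \<otimes>\<^bsub>kA4\<^esub> f = ga_scale s (K3_idem \<chi>)"
      "h \<otimes>\<^bsub>kA4\<^esub> K3_idem \<chi> = ga_scale t (K3_idem \<chi>)" "K3_idem \<chi> \<otimes>\<^bsub>kA4\<^esub> h = ga_scale t (K3_idem \<chi>)"
      by blast
    then show ?case
      unfolding kK_simps using add(1,2)[THEN kK_carrier_subset]
      by (intro exI[of _ "s + t"])
        (simp add: kA4.l_distr kA4.r_distr ga_scale_add_left[where G = A4])
  qed
  then show thesis using that by blast
qed

lemma K3_idem_central_kK: "central_elem kK (K3_idem \<chi>)"
  unfolding central_elem_def kK_simps using K3_idem_in_kK kK_act by metis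

lemma K3_idem_primitive_kK: "primitive_idempotent kK (K3_idem \<chi>)"
proof -
  have idem: "idempotent_elem kA4 a" if "idempotent_elem kK a" for a :: "_ \<Rightarrow> 'k"
    using that kK_carrier_subset unfolding idempotent_elem_def kK_simps by blast
  have "idempotent_elem kK (K3_idem \<chi>)"
    using K3_idem_in_kK K3_idem_idem[OF char chi] unfolding idempotent_elem_def kK_simps by blast
  then show ?thesis
    using K3_idem_primitive[OF char chi] idem
    unfolding primitive_idempotent_def orthogonal_elems_def kK_simps by blast
qed

text \<open>An idempotent \<open>e\<close> of \<open>kK\<close> has \<open>e f = s f\<close> with \<open>s\<^sup>2 = s\<close> for \<open>f = K3_idem \<chi>\<close>. If \<open>s = 1\<close>, then
  \<open>e = f + (e - f)\<close> is an orthogonal decomposition.\<close>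

lemma primitive_kK_cases:
  assumes prim: "primitive_idempotent kK e"
  shows "e \<otimes>\<^bsub>kA4\<^esub> K3_idem \<chi> = \<zero>\<^bsub>kA4\<^esub> \<or> e = K3_idem \<chi>"
proof (rule ccontr)
  let ?f = "K3_idem \<chi>"
  assume neg: "\<not> ?thesis"
  have e_in_kK: "e \<in> carrier kK" and ee: "e \<otimes>\<^bsub>kA4\<^esub> e = e"
    using prim unfolding primitive_idempotent_def idempotent_elem_def kK_simps by blast+
  have eA: "e \<in> carrier kA4" using e_in_kK by (rule kK_carrier_subset)
  note ff = K3_idem_idem[OF char chi]
  obtain s where ef: "e \<otimes>\<^bsub>kA4\<^esub> ?f = ga_scale s ?f" and fe: "?f \<otimes>\<^bsub>kA4\<^esub> e = ga_scale s ?f"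
    using kK_act[OF e_in_kK] .
  have "s \<noteq> 0" using neg ef by (metis ga_scale_0)
  have "ga_scale (s * s) ?f = e \<otimes>\<^bsub>kA4\<^esub> (e \<otimes>\<^bsub>kA4\<^esub> ?f)"
    unfolding ef using eA by (simp add: ga_scale_mult ef)
  also have "\<dots> = (e \<otimes>\<^bsub>kA4\<^esub> e) \<otimes>\<^bsub>kA4\<^esub> ?f"
    using eA by (intro kA4.m_assoc[symmetric]) simp_all
  also have "\<dots> = ga_scale s ?f" unfolding ee ef ..
  finally have "ga_scale (s * s) ?f id = ga_scale s ?f id" by simp
  then have "s = 1" using \<open>s \<noteq> 0\<close> by (simp add: ga_scale_def K3_idem_id)
  with ef fe have ef: "e \<otimes>\<^bsub>kA4\<^esub> ?f = ?f" and fe: "?f \<otimes>\<^bsub>kA4\<^esub> e = ?f" by simp_all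
  have two: "x \<oplus>\<^bsub>kA4\<^esub> x = \<zero>\<^bsub>kA4\<^esub>" for x :: "(nat \<Rightarrow> nat) \<Rightarrow> 'k"
    by (rule ext) (simp add: group_algebra_add group_algebra_zero two_eq_zero[OF char] flip: mult_2)
  \<comment> \<open>In characteristic 2 the difference is a sum.\<close>
  define b where "b = e \<oplus>\<^bsub>kA4\<^esub> ?f"
  have bK: "b \<in> carrier kK"
    unfolding b_def using group_algebra_add_closed[OF e_in_kK K3_idem_in_kK] unfolding kK_simps .
  have "e = ?f \<oplus>\<^bsub>kA4\<^esub> b" using eA by (simp add: b_def kA4.a_ac two)
  moreover have "b \<noteq> \<zero>\<^bsub>kA4\<^esub>"
    using neg calculation by auto
  moreover have "?f \<otimes>\<^bsub>kA4\<^esub> b = \<zero>\<^bsub>kA4\<^esub>" "b \<otimes>\<^bsub>kA4\<^esub> ?f = \<zero>\<^bsub>kA4\<^esub>"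
    using eA by (simp_all add: b_def kA4.l_distr kA4.r_distr ef fe ff two)
  moreover have "b \<otimes>\<^bsub>kA4\<^esub> b = b"
    using eA by (simp add: b_def kA4.l_distr kA4.r_distr ef fe ff ee two)
  ultimately show False
    using prim bK K3_idem_in_kK[of \<chi>] ff K3_idem_nonzero[of \<chi>]
    unfolding primitive_idempotent_def idempotent_elem_def orthogonal_elems_def kK_simps by blast
qed

section \<open>Projective covers\<close>

text \<open>The map is \<open>x \<mapsto> x t\<close> for a generator \<open>t\<close> of \<open>T\<close>; the condition \<open>\<chi> \<mu> = 1\<close> says that \<open>e = K3_idem \<chi>\<close> fixes
  \<open>t\<close>. If a submodule \<open>U\<close> still maps onto \<open>T\<close>, it contains some \<open>y\<close> with \<open>y t = t\<close>. Then \<open>e y \<in> U\<close> lies in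
  the corner and fixes \<open>t\<close>, so its coefficients add up to 1 and its square, which is again in \<open>U\<close>, is \<open>e\<close>.\<close>

lemma K3_idem_left_ideal_essential:
  fixes T :: "((nat \<Rightarrow> nat) \<Rightarrow> 'k, 'm) module"
  assumes T: "one_dim_A4_module \<mu> T" and mu: "\<chi> * \<mu> = 1"
  shows "\<exists>f. essential_epi kA4 (left_ideal_module kA4 (K3_idem \<chi>)) T f"
proof -
  let ?e = "K3_idem \<chi>"
  interpret T: left_module kA4 T using T by (simp add: one_dim_A4_module_def)
  obtain t where t: "t \<in> carrier T" "t \<noteq> \<zero>\<^bsub>T\<^esub>" "carrier T = {ga_single id a \<odot>\<^bsub>T\<^esub> t | a. True}"
    using T unfolding one_dim_A4_module_def by blast
  have V_act: "ga_single v 1 \<odot>\<^bsub>T\<^esub> t = t" if "v \<in> {v1, v2, v3}" for v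
    using T that t(1) V4_elems unfolding one_dim_A4_module_def by blast
  have c_act: "ga_single c123 1 \<odot>\<^bsub>T\<^esub> t = ga_single id \<mu> \<odot>\<^bsub>T\<^esub> t"
    using T t(1) unfolding one_dim_A4_module_def by blast
  have id_act: "ga_single id 1 \<odot>\<^bsub>T\<^esub> t = t"
    using T.smult_one[OF t(1)] by (simp add: kA4_one)
  have id_id: "ga_single id a \<odot>\<^bsub>T\<^esub> (ga_single id b \<odot>\<^bsub>T\<^esub> t) = ga_single id (a * b) \<odot>\<^bsub>T\<^esub> t" for a b
    using t(1) by (simp flip: T.smult_assoc)
  have id_add: "ga_single id a \<odot>\<^bsub>T\<^esub> t \<oplus>\<^bsub>T\<^esub> ga_single id b \<odot>\<^bsub>T\<^esub> t = ga_single id (a + b) \<odot>\<^bsub>T\<^esub> t" for a b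
    using t(1) by (simp add: ga_single_add flip: T.smult_l_distr)
  have id_zero: "ga_single id 0 \<odot>\<^bsub>T\<^esub> t = \<zero>\<^bsub>T\<^esub>"
    using id_add[of 0 0] t(1) T.smult_closed by (metis A4_perm_closed(1) T.M.add.r_cancel_one' add_0 ga_single_closed)
  have c_act': "ga_single c123 a \<odot>\<^bsub>T\<^esub> t = ga_single id (a * \<mu>) \<odot>\<^bsub>T\<^esub> t" for a
  proof -
    have "ga_single c123 a \<odot>\<^bsub>T\<^esub> t = (ga_single id a \<otimes>\<^bsub>kA4\<^esub> ga_single c123 1) \<odot>\<^bsub>T\<^esub> t" by simp
    also have "\<dots> = ga_single id (a * \<mu>) \<odot>\<^bsub>T\<^esub> t"
      using t(1) by (simp add: T.smult_assoc c_act id_id del: kA4_single_mult)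
    finally show ?thesis .
  qed
  have c2_act: "ga_single c132 a \<odot>\<^bsub>T\<^esub> t = ga_single id (a * \<mu>^2) \<odot>\<^bsub>T\<^esub> t" for a
  proof -
    have "ga_single c132 a \<odot>\<^bsub>T\<^esub> t =
        (ga_single c123 a \<otimes>\<^bsub>kA4\<^esub> ga_single c123 1) \<odot>\<^bsub>T\<^esub> t" by simp
    also have "\<dots> = ga_single c123 a \<odot>\<^bsub>T\<^esub> (ga_single id \<mu> \<odot>\<^bsub>T\<^esub> t)"
      using t(1) by (simp add: T.smult_assoc c_act del: kA4_single_mult)
    also have "\<dots> = ga_single c123 (a * \<mu>) \<odot>\<^bsub>T\<^esub> t"
      using t(1) by (simp flip: T.smult_assoc)
    finally show ?thesis by (simp add: c_act' power2_eq_square mult.assoc)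
  qed
  have t3: "t \<oplus>\<^bsub>T\<^esub> t \<oplus>\<^bsub>T\<^esub> t = t"
    using id_add[of 1 1] id_add[of "1 + 1" 1] by (simp add: id_act three_eq_one[OF char])
  have mu2: "\<chi>^2 * \<mu>^2 = 1" using mu by (simp flip: power_mult_distrib)
  have e_act: "?e \<odot>\<^bsub>T\<^esub> t = t"
    unfolding K3_idem_def using t(1)
    by (simp add: T.smult_l_distr c_act' c2_act mu mu2 id_act del: T.M.add.r_cancel_one) (rule t3)
  have w_act: "V4_sum \<odot>\<^bsub>T\<^esub> t = t"
    unfolding V4_sum_def using t(1)
    by (simp add: T.smult_l_distr V_act del: T.M.add.r_cancel_one) (rule t3)
  have scale_act: "ga_scale a x \<odot>\<^bsub>T\<^esub> t = ga_single id a \<odot>\<^bsub>T\<^esub> (x \<odot>\<^bsub>T\<^esub> t)" if "x \<in> carrier kA4" for a x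
    using that t(1) by (simp add: kA4_single_id_mult flip: T.smult_assoc)
  let ?f = "\<lambda>x. x \<odot>\<^bsub>T\<^esub> t"
  note ideal_sub = kA4.left_ideal_gen_subset[OF K3_idem_closed[of \<chi>], THEN subsetD]
  have hom: "?f \<in> left_module_hom kA4 (left_ideal_module kA4 ?e) T"
    using t(1) ideal_sub
    by (auto simp: left_module_hom_def T.smult_closed T.smult_l_distr T.smult_assoc)
  have "?f ` left_ideal_gen kA4 ?e = carrier T"
  proof
    show "?f ` left_ideal_gen kA4 ?e \<subseteq> carrier T"
      using t(1) ideal_sub by (auto simp: T.smult_closed)
    show "carrier T \<subseteq> ?f ` left_ideal_gen kA4 ?e"
    proof
      fix y assume "y \<in> carrier T"
      then obtain a where y: "y = ga_single id a \<odot>\<^bsub>T\<^esub> t" using t(3) by blast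
      have "y = ?f (ga_single id a \<otimes>\<^bsub>kA4\<^esub> ?e)"
        using t(1) by (simp add: y T.smult_assoc e_act)
      moreover have "ga_single id a \<otimes>\<^bsub>kA4\<^esub> ?e \<in> left_ideal_gen kA4 ?e"
        unfolding left_ideal_gen_def by auto
      ultimately show "y \<in> ?f ` left_ideal_gen kA4 ?e" by blast
    qed
  qed
  moreover have "U = left_ideal_gen kA4 ?e"
    if U: "submodule U kA4 (left_ideal_module kA4 ?e)" and onto: "?f ` U = carrier T" for U
  proof -
    interpret U: submodule U kA4 "left_ideal_module kA4 ?e" by (rule U)
    have U_sub: "U \<subseteq> left_ideal_gen kA4 ?e" using U.subset by simp
    have U_mult: "a \<otimes>\<^bsub>kA4\<^esub> x \<in> U" if "a \<in> carrier kA4" "x \<in> U" for a x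
      using U.smult_closed[OF that] by simp
    obtain y where y: "y \<in> U" "y \<odot>\<^bsub>T\<^esub> t = t" using onto t(1) by (metis imageE)
    have yA: "y \<in> carrier kA4" using y U_sub ideal_sub by blast
    have "y \<otimes>\<^bsub>kA4\<^esub> ?e = y"
      using kA4.left_ideal_gen_idempotent[of ?e y] K3_idem_idem[OF char chi] y(1) U_sub
      by (auto simp: idempotent_elem_def)
    then obtain \<alpha> \<beta> where x: "?e \<otimes>\<^bsub>kA4\<^esub> y =
        ga_scale \<alpha> ?e \<oplus>\<^bsub>kA4\<^esub> ga_scale \<beta> (V4_sum \<otimes>\<^bsub>kA4\<^esub> ?e)"
      using corner_element[OF char chi yA] by metis
    have "t = (?e \<otimes>\<^bsub>kA4\<^esub> y) \<odot>\<^bsub>T\<^esub> t"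
      using yA t(1) by (simp add: T.smult_assoc y(2) e_act)
    also have "\<dots> = ga_single id (\<alpha> + \<beta>) \<odot>\<^bsub>T\<^esub> t"
      unfolding x using t(1)
      by (simp add: T.smult_l_distr scale_act T.smult_assoc e_act w_act id_add)
    finally have ab: "ga_single id (\<alpha> + \<beta>) \<odot>\<^bsub>T\<^esub> t = t" by simp
    have "\<alpha> + \<beta> = 1"
    proof (rule ccontr)
      \<comment> \<open>In characteristic 2 this is \<open>\<alpha> + \<beta> - 1\<close>, a scalar that annihilates \<open>t\<close>.\<close>
      define s where "s = \<alpha> + \<beta> + 1"
      assume "\<alpha> + \<beta> \<noteq> 1"
      moreover have "\<alpha> + \<beta> = s + 1"
        using two_eq_zero[OF char] by (simp add: s_def add.assoc)
      ultimately have "s \<noteq> 0" by auto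
      have "ga_single id s \<odot>\<^bsub>T\<^esub> t = ga_single id (\<alpha> + \<beta>) \<odot>\<^bsub>T\<^esub> t \<oplus>\<^bsub>T\<^esub> ga_single id 1 \<odot>\<^bsub>T\<^esub> t"
        unfolding s_def by (rule id_add[symmetric])
      also have "\<dots> = t \<oplus>\<^bsub>T\<^esub> t" by (simp only: ab id_act)
      also have "\<dots> = \<zero>\<^bsub>T\<^esub>"
        using id_add[of 1 1] by (simp add: id_act two_eq_zero[OF char] id_zero)
      finally have "ga_single id (inverse s) \<odot>\<^bsub>T\<^esub> (ga_single id s \<odot>\<^bsub>T\<^esub> t)
          = ga_single id (inverse s) \<odot>\<^bsub>T\<^esub> (ga_single id 0 \<odot>\<^bsub>T\<^esub> t)"
        by (simp add: id_zero)
      then have "ga_single id (inverse s * s) \<odot>\<^bsub>T\<^esub> t = ga_single id (inverse s * 0) \<odot>\<^bsub>T\<^esub> t"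
        unfolding id_id .
      then show False using \<open>s \<noteq> 0\<close> t(2) by (simp add: id_act id_zero)
    qed
    then have "(?e \<otimes>\<^bsub>kA4\<^esub> y) \<otimes>\<^bsub>kA4\<^esub> (?e \<otimes>\<^bsub>kA4\<^esub> y) = ?e"
      using corner_square[OF char chi x] by simp
    then have "?e \<in> U" using U_mult y(1) yA by (metis K3_idem_closed kA4.m_closed)
    then show ?thesis using U_sub U_mult by (auto simp: left_ideal_gen_def)
  qed
  ultimately show ?thesis using hom unfolding essential_epi_def by auto
qed

lemma K3_idem_projective_cover:
  fixes T :: "((nat \<Rightarrow> nat) \<Rightarrow> 'k, 'm) module"
  assumes T: "one_dim_A4_module \<mu> T" and mu: "\<chi> * \<mu> = 1"
  shows "is_projective_cover kA4 (left_ideal_module kA4 (K3_idem \<chi>)) T"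
  unfolding is_projective_cover_def
  using T K3_idem_left_ideal_essential[OF T mu]
    kA4.left_ideal_projective[of "K3_idem \<chi>"] K3_idem_idem[OF char chi]
  by (auto simp: one_dim_A4_module_def idempotent_elem_def)

end

section \<open>The decomposition of the group algebra\<close>

theorem mainTheorem5:
  fixes \<omega> :: "'k::alg_closed_field"
  assumes char_two: "CHAR('k) = 2"
    and omega: "\<omega>^2 + \<omega> + 1 = 0"
  shows
    "{e_idem \<omega> 1, e_idem \<omega> 2, e_idem \<omega> 3} =
       {e :: (nat \<Rightarrow> nat) \<Rightarrow> 'k. central_elem kK e \<and> primitive_idempotent kK e} \<and>
     (\<forall>i\<in>{1,2,3}. \<forall>j\<in>{1,2,3}. i \<noteq> j \<longrightarrow> orthogonal_elems kK (e_idem \<omega> i) (e_idem \<omega> j)) \<and>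
     (\<forall>i\<in>{1,2,3}. primitive_idempotent kA4 (e_idem \<omega> i)) \<and>
     (\<forall>i\<in>{1,2,3}. \<forall>j\<in>{1,2,3}. i \<noteq> j \<longrightarrow> orthogonal_elems kA4 (e_idem \<omega> i) (e_idem \<omega> j)) \<and>
     \<one>\<^bsub>kA4\<^esub> = e_idem \<omega> 1 \<oplus>\<^bsub>kA4\<^esub> e_idem \<omega> 2 \<oplus>\<^bsub>kA4\<^esub> e_idem \<omega> 3 \<and>
     internal_direct_sum kA4 (regular_module kA4) {1::nat, 2, 3}
       (\<lambda>i. left_ideal_gen kA4 (e_idem \<omega> i)) \<and>
     (\<forall>T :: ((nat \<Rightarrow> nat) \<Rightarrow> 'k, 'm) module.
        (one_dim_A4_module 1 T \<longrightarrow>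
           is_projective_cover kA4 (left_ideal_module kA4 (e_idem \<omega> 1)) T) \<and>
        (one_dim_A4_module \<omega> T \<longrightarrow>
           is_projective_cover kA4 (left_ideal_module kA4 (e_idem \<omega> 3)) T) \<and>
        (one_dim_A4_module (\<omega>^2) T \<longrightarrow>
           is_projective_cover kA4 (left_ideal_module kA4 (e_idem \<omega> 2)) T))"
proof -
  have "(\<omega> - 1) * (\<omega>^2 + \<omega> + 1) = \<omega>^3 - 1" by (simp add: algebra_simps power2_eq_square power3_eq_cube)
  then have w3: "\<omega>^3 = 1" using omega by simp
  have w6: "(\<omega>^2)^3 = 1" using w3 by (metis power_mult mult.commute power_one)
  have w4: "\<omega>^4 = \<omega>" using w3 by (simp add: numeral_eq_Suc)
  note three = three_eq_one[OF char_two]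
  have w1: "\<omega> \<noteq> 1" using omega three by auto
  have w2: "\<omega>^2 \<noteq> 1" using w1 w3 by (metis mult_1 power2_eq_square power3_eq_cube)
  have w0: "\<omega> \<noteq> 0" using omega by auto
  have w12: "\<omega>^2 \<noteq> \<omega>" using w1 w0 by (simp add: power2_eq_square)
  have e: "e_idem \<omega> 1 = K3_idem 1" "e_idem \<omega> 2 = K3_idem \<omega>" "e_idem \<omega> 3 = K3_idem (\<omega>^2)"
    by (simp_all add: e_idem_def K3_idem_def w4)
  \<comment> \<open>The cube root of unity belonging to the index \<open>i\<close>.\<close>
  define r where "r i = (if i = 1 then 1 else if i = 2 then \<omega> else \<omega>^2)" for i :: nat
  have r3: "r i ^ 3 = 1" for i using w3 w6 unfolding r_def by (auto simp only: power_one split: if_split)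
  have r_inj: "r i \<noteq> r j" if "i \<in> {1, 2, 3}" "j \<in> {1, 2, 3}" "i \<noteq> j" for i j
    using that w1 w2 w12 unfolding r_def by auto
  have er: "e_idem \<omega> i = K3_idem (r i)" for i
    by (simp add: e_idem_def K3_idem_def r_def w4)
  have one: "\<one>\<^bsub>kA4\<^esub> = K3_idem 1 \<oplus>\<^bsub>kA4\<^esub> K3_idem \<omega> \<oplus>\<^bsub>kA4\<^esub> K3_idem (\<omega>^2)"
  proof
    fix x
    have "1 + (\<omega> + \<omega>^2) = 0" "1 + (\<omega>^2 + \<omega>) = 0" using omega by (simp_all add: ac_simps)
    then show "\<one>\<^bsub>kA4\<^esub> x = (K3_idem 1 \<oplus>\<^bsub>kA4\<^esub> K3_idem \<omega> \<oplus>\<^bsub>kA4\<^esub> K3_idem (\<omega>^2)) x"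
      by (simp add: kA4_one K3_idem_def group_algebra_add ga_single_def three w4)
  qed
  have orth: "orthogonal_elems kA4 (e_idem \<omega> i) (e_idem \<omega> j)"
    if "i \<in> {1, 2, 3}" "j \<in> {1, 2, 3}" "i \<noteq> j" for i j
    unfolding er orthogonal_elems_def using r_inj[OF that]
    by (simp add: K3_idem_orthogonal[OF char_two r3 r3])
  have idem: "idempotent_elem kA4 (e_idem \<omega> i)" for i
    by (simp add: er idempotent_elem_def K3_idem_idem[OF char_two r3])
  have "{e_idem \<omega> 1, e_idem \<omega> 2, e_idem \<omega> 3} =
      {e :: (nat \<Rightarrow> nat) \<Rightarrow> 'k. central_elem kK e \<and> primitive_idempotent kK e}"
  proof (intro equalityI subsetI)
    fix x assume "x \<in> {e_idem \<omega> 1, e_idem \<omega> 2, e_idem \<omega> 3}"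
    then obtain i where "x = K3_idem (r i)" using er by blast
    then show "x \<in> {e. central_elem kK e \<and> primitive_idempotent kK e}"
      using K3_idem_central_kK[OF char_two r3] K3_idem_primitive_kK[OF char_two r3] by simp
  next
    fix x :: "(nat \<Rightarrow> nat) \<Rightarrow> 'k"
    assume "x \<in> {e. central_elem kK e \<and> primitive_idempotent kK e}"
    then have prim: "primitive_idempotent kK x" by simp
    then have xA: "x \<in> carrier kA4" and "x \<noteq> \<zero>\<^bsub>kA4\<^esub>"
      using kK_carrier_subset
      unfolding primitive_idempotent_def idempotent_elem_def kK_simps by blast+
    show "x \<in> {e_idem \<omega> 1, e_idem \<omega> 2, e_idem \<omega> 3}"
    proof (rule ccontr)
      assume "x \<notin> {e_idem \<omega> 1, e_idem \<omega> 2, e_idem \<omega> 3}"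
      then have "x \<otimes>\<^bsub>kA4\<^esub> K3_idem \<chi> = \<zero>\<^bsub>kA4\<^esub>" if "\<chi> \<in> {1, \<omega>, \<omega>^2}" for \<chi>
        using that e primitive_kK_cases[OF char_two _ prim, of \<chi>] w3 w6 by auto
      then have "x \<otimes>\<^bsub>kA4\<^esub> \<one>\<^bsub>kA4\<^esub> = \<zero>\<^bsub>kA4\<^esub>"
        unfolding one using xA by (simp add: kA4.r_distr)
      then show False using xA \<open>x \<noteq> \<zero>\<^bsub>kA4\<^esub>\<close> by simp
    qed
  qed
  moreover have "orthogonal_elems kK (e_idem \<omega> i) (e_idem \<omega> j)"
    if "i \<in> {1, 2, 3}" "j \<in> {1, 2, 3}" "i \<noteq> j" for i j
    using orth[OF that] unfolding orthogonal_elems_def kK_simps .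
  moreover have "primitive_idempotent kA4 (e_idem \<omega> i)" for i
    unfolding er by (rule K3_idem_primitive[OF char_two r3])
  moreover have "internal_direct_sum kA4 (regular_module kA4) {1::nat, 2, 3}
      (\<lambda>i. left_ideal_gen kA4 (e_idem \<omega> i))"
  proof (rule kA4.internal_direct_sum_left_ideals)
    show "\<one>\<^bsub>kA4\<^esub> = (\<Oplus>\<^bsub>kA4\<^esub>i\<in>{1::nat, 2, 3}. e_idem \<omega> i)"
      unfolding er by (simp add: one kA4.finsum_insert r_def kA4.a_assoc)
  qed (use idem orth in auto)
  moreover have "is_projective_cover kA4 (left_ideal_module kA4 (K3_idem \<chi>)) T"
    if "one_dim_A4_module \<mu> T" "\<chi>^3 = 1" "\<chi> * \<mu> = 1"
    for T :: "((nat \<Rightarrow> nat) \<Rightarrow> 'k, 'm) module" and \<mu> \<chi>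
    using K3_idem_projective_cover[OF char_two that(2,1,3)] .
  moreover have "\<omega>^2 * \<omega> = 1" "\<omega> * \<omega>^2 = 1"
    using w3 by (simp_all add: power2_eq_square power3_eq_cube mult_ac)
  ultimately show ?thesis
    unfolding e using one w3 w6 orth by simp
qed

end
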